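(* Let $D\subset\mathbb C^n$ be a $\mathbb C$-convex domain, let $z\in D$ and $X\in\mathbb C^n\setminus\{0\}$, and suppose that $D$ does not contain the complex line through $z$ in direction $X$. Then $$\frac14\le\gamma_D(z;X)\,d_D(z,X)\le\kappa_D(z;X)\,d_D(z,X)\le1.$$
   Context: A domain $D\subset\mathbb C^n$ is $\mathbb C$-convex if every non-empty intersection of $D$ with a complex (affine) line is a simply connected domain (in particular connected). $d_D(z,X)=\sup\{r>0: z+\lambda X\in D \text{ for all }\lambda\in\mathbb C,\ |\lambda|<r\}$. Let $\mathbb D\subset\mathbb C$ be the unit disc and $\mathcal O(A,B)$ the set of holomorphic maps $A\to B$. The Carathéodory metric is $\gamma_D(z;X)=\sup\{|f'(z)X|: f\in\mathcal O(D,\mathbb D),\ f(z)=0\}$; the Kobayashi metric is $\kappa_D(z;X)=\inf\{\alpha\ge0:\exists\varphi\in\mathcal O(\mathbb D,D):\varphi(0)=z,\ \alpha\varphi'(0)=X\}$. *)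

theory Defs
  imports "HOL-Analysis.Analysis"
begin

definition complex_domain :: "(complex ^ 'n) set \<Rightarrow> bool" where
  "complex_domain D \<longleftrightarrow> open D \<and> connected D \<and> D \<noteq> {}"

definition complex_line :: "complex ^ 'n \<Rightarrow> complex ^ 'n \<Rightarrow> (complex ^ 'n) set" where
  "complex_line a v = range (\<lambda>t::complex. a + t *s v)"

text \<open>The intersection with a line is automatically open in that line, and
  \<^const>\<open>simply_connected\<close> entails path-connectedness, so a non-empty simply connected
  intersection is a simply connected domain in the line.\<close>

definition C_convex :: "(complex ^ 'n) set \<Rightarrow> bool" where
  "C_convex D \<longleftrightarrow>
     (\<forall>a v. v \<noteq> 0 \<longrightarrow> D \<inter> complex_line a v \<noteq> {} \<longrightarrow> simply_connected (D \<inter> complex_line a v))"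

text \<open>The distance to the boundary in direction \<open>X\<close>. As a supremum of reals it is meaningful
  only if the set is non-empty and bounded; this holds for open \<open>D\<close> containing \<open>z\<close> but not the
  whole line \<open>complex_line z X\<close>.\<close>

definition directional_dist :: "(complex ^ 'n) set \<Rightarrow> complex ^ 'n \<Rightarrow> complex ^ 'n \<Rightarrow> real" where
  "directional_dist D z X = Sup {r. r > 0 \<and> (\<forall>t::complex. norm t < r \<longrightarrow> z + t *s X \<in> D)}"

text \<open>Holomorphic functions of several variables on an open set: the real Frechet derivative
  exists at every point and is complex-linear.\<close>

definition holomorphic_fun_on :: "(complex ^ 'n \<Rightarrow> complex) \<Rightarrow> (complex ^ 'n) set \<Rightarrow> bool" where
  "holomorphic_fun_on f D \<longleftrightarrow>
     (\<forall>z\<in>D. \<exists>L. (f has_derivative L) (at z) \<and> (\<forall>c v. L (c *s v) = c * L v))"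

definition holomorphic_curve_on :: "(complex \<Rightarrow> complex ^ 'n) \<Rightarrow> complex set \<Rightarrow> bool" where
  "holomorphic_curve_on \<phi> U \<longleftrightarrow> (\<forall>i. (\<lambda>t. \<phi> t $ i) holomorphic_on U)"

definition curve_deriv :: "(complex \<Rightarrow> complex ^ 'n) \<Rightarrow> complex \<Rightarrow> complex ^ 'n" where
  "curve_deriv \<phi> t = (\<chi> i. deriv (\<lambda>s. \<phi> s $ i) t)"

text \<open>For open \<open>D\<close> and \<open>z \<in> D\<close> the set below is bounded by the Schwarz lemma (and contains 0).\<close>

definition caratheodory_metric :: "(complex ^ 'n) set \<Rightarrow> complex ^ 'n \<Rightarrow> complex ^ 'n \<Rightarrow> real" where
  "caratheodory_metric D z X =
     Sup {norm (frechet_derivative f (at z) X) | f.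
            holomorphic_fun_on f D \<and> f ` D \<subseteq> ball 0 1 \<and> f z = 0}"

text \<open>For open \<open>D\<close> and \<open>z \<in> D\<close> the set below is non-empty: small affine discs are admissible.\<close>

definition kobayashi_metric :: "(complex ^ 'n) set \<Rightarrow> complex ^ 'n \<Rightarrow> complex ^ 'n \<Rightarrow> real" where
  "kobayashi_metric D z X =
     Inf {\<alpha>. \<alpha> \<ge> 0 \<and> (\<exists>\<phi>. holomorphic_curve_on \<phi> (ball 0 1) \<and> \<phi> ` ball 0 1 \<subseteq> D \<and>
                \<phi> 0 = z \<and> complex_of_real \<alpha> *s curve_deriv \<phi> 0 = X)}"

end

theory Submission
  imports Defs "HOL-Complex_Analysis.Complex_Analysis"
begin

text \<open>The bound \<open>\<kappa> d \<le> 1\<close> comes from affine discs and \<open>\<gamma> \<le> \<kappa>\<close> from the Schwarz lemma. For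
  \<open>1/4 \<le> \<gamma> d\<close>, take a point \<open>w = z + t X\<close> outside \<open>D\<close>. A complex hyperplane through \<open>w\<close> misses
  \<open>D\<close>; projecting along it maps \<open>D\<close> onto a simply connected plane domain \<open>G\<close> omitting the image
  of \<open>w\<close>, and Koebe's quarter theorem for a Riemann map of \<open>G\<close> gives \<open>\<gamma> \<ge> 1 / (4 \<bar>t\<bar>)\<close>.

  The topology is phrased through continuous logarithms. If \<open>D\<close> is fibred by slices with complex
  lines, logarithms on the slices fit together, so \<open>D\<close> itself has all logarithms, and so does \<open>G\<close>.
  If every hyperplane \<open>b = p a\<close> of a pencil, including \<open>a = 0\<close>, met \<open>D\<close>, then \<open>a\<close> would have a
  logarithm over \<open>\<bar>p\<bar> \<le> 1\<close> and \<open>b\<close> one over \<open>\<bar>p\<bar> \<ge> 1\<close>, hence \<open>p = b / a\<close> one on the unit circle.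

  For Koebe's theorem, a square root and a Cayley transform reduce to an injective \<open>t\<close> on the disc
  with \<open>t 0 = 0\<close> and \<open>t z * t w \<noteq> 1\<close>. Then \<open>t\<close> and \<open>1/t\<close> have disjoint ranges, and comparing areas in
  the logarithmic metric \<open>\<bar>dw\<bar> / \<bar>w\<bar>\<close> yields \<open>\<bar>t' 0\<bar> \<le> 1\<close>.\<close>

unbundle no fps_syntax

section \<open>Continuous logarithms\<close>

text \<open>Distinct logarithms of one number are at least 2 pi apart, so \<open>h\<close> has
  discrete range on a connected set. Branches of a logarithm are compared in this way
  throughout.\<close>

lemma exp_constant_imp_constant_on:
  fixes h :: "'a::topological_space \<Rightarrow> complex"
  assumes "connected S" "continuous_on S h" "\<And>x. x \<in> S \<Longrightarrow> exp (h x) = c"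
  shows "h constant_on S"
proof (rule continuous_discrete_range_constant[OF assms(1,2)])
  fix x assume x: "x \<in> S"
  have "h y = h x" if "y \<in> S" "cmod (h y - h x) < 2 * pi" for y
  proof (rule exp_complex_eqI)
    have "\<bar>Im (h y) - Im (h x)\<bar> \<le> cmod (h y - h x)"
      by (metis abs_Im_le_cmod minus_complex.simps(2))
    then show "\<bar>Im (h y) - Im (h x)\<bar> < 2 * pi"
      using that by linarith
    show "exp (h y) = exp (h x)"
      using assms(3) that x by metis
  qed
  then show "\<exists>e>0. \<forall>y. y \<in> S \<and> h y \<noteq> h x \<longrightarrow> e \<le> cmod (h y - h x)"
    by (intro exI[of _ "2 * pi"]) force
qed

text \<open>As a function of the angle \<theta>, the value of \<open>g\<close> minus i \<theta>
  would be a continuous logarithm of 1, hence constant; but a full turn restores \<open>g\<close>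
  and changes \<theta> by 2 pi.\<close>

lemma no_continuous_logarithm_on_circle:
  assumes "continuous_on (sphere 0 1) g"
  shows "\<exists>p \<in> sphere 0 1. exp (g p) \<noteq> (p::complex)"
proof (rule ccontr)
  assume "\<not> ?thesis"
  then have e: "exp (g p) = p" if "p \<in> sphere 0 1" for p
    using that by auto
  define h where "h \<equiv> \<lambda>\<theta>::real. g (exp (\<i> * of_real \<theta>)) - \<i> * of_real \<theta>"
  have "continuous_on UNIV h"
    unfolding h_def
    by (intro continuous_intros continuous_on_compose2[OF assms]) auto
  moreover have "exp (h \<theta>) = 1" for \<theta>
    using e[of "exp (\<i> * of_real \<theta>)"] by (simp add: h_def exp_diff)
  ultimately have "h constant_on UNIV"
    using exp_constant_imp_constant_on[of UNIV h 1] by simp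
  then have "h 0 = h (2 * pi)"
    unfolding constant_on_def by (metis UNIV_I)
  moreover have "exp (\<i> * of_real (2 * pi)) = 1"
    using exp_two_pi_i by (simp add: mult_ac)
  ultimately show False
    by (simp add: h_def)
qed

text \<open>The composition of \<open>f\<close> with \<pi> is constant on fibres, so
  \<open>L\<close> is constant on each connected fibre and factors through \<pi>; openness of \<pi>
  makes the factor continuous.\<close>

lemma continuous_logarithm_descends:
  fixes \<pi> :: "'a::topological_space \<Rightarrow> 'b::topological_space"
  assumes "\<pi> ` S = T"
    and ope: "\<And>U. openin (top_of_set S) U \<Longrightarrow> openin (top_of_set T) (\<pi> ` U)"
    and conn: "\<And>y. y \<in> T \<Longrightarrow> connected (S \<inter> \<pi> -` {y})"
    and contL: "continuous_on S L" and L: "\<And>x. x \<in> S \<Longrightarrow> exp (L x) = f (\<pi> x)"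
  obtains g where "continuous_on T g" "\<And>y. y \<in> T \<Longrightarrow> exp (g y) = (f y :: complex)"
proof -
  have "\<forall>y\<in>T. \<exists>x\<in>S. \<pi> x = y"
    using assms(1) by blast
  then obtain r where r: "\<And>y. y \<in> T \<Longrightarrow> r y \<in> S \<and> \<pi> (r y) = y"
    by metis
  have const: "L x = L (r (\<pi> x))" if "x \<in> S" for x
  proof -
    have y: "\<pi> x \<in> T"
      using assms(1) that by blast
    have "L constant_on (S \<inter> \<pi> -` {\<pi> x})"
    proof (rule exp_constant_imp_constant_on[OF conn[OF y]])
      show "continuous_on (S \<inter> \<pi> -` {\<pi> x}) L"
        by (rule continuous_on_subset[OF contL]) auto
      show "exp (L u) = f (\<pi> x)" if "u \<in> S \<inter> \<pi> -` {\<pi> x}" for u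
        using that L by auto
    qed
    then show ?thesis
      using r[OF y] that unfolding constant_on_def by fastforce
  qed
  show ?thesis
  proof
    show "continuous_on T (\<lambda>y. L (r y))"
      unfolding continuous_on_open_gen[OF image_subset_iff_funcset[THEN iffD1, OF subset_UNIV]]
    proof (intro allI impI)
      fix U :: "complex set" assume "openin (top_of_set UNIV) U"
      then have "openin (top_of_set S) (S \<inter> L -` U)"
        using continuous_openin_preimage_gen[OF contL] by simp
      moreover have "\<pi> ` (S \<inter> L -` U) = T \<inter> (\<lambda>y. L (r y)) -` U"
        using const r assms(1) by (fastforce simp: image_iff)
      ultimately show "openin (top_of_set T) (T \<inter> (\<lambda>y. L (r y)) -` U)"
        using ope by metis
    qed
    show "exp (L (r y)) = f y" if "y \<in> T" for y
      using that r L by metis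
  qed
qed

text \<open>Borsukian means that zero-free continuous functions have continuous logarithms. A
  function on \<open>T\<close> is pulled back to \<open>S\<close>, and its logarithm there
  descends.\<close>

lemma Borsukian_open_monotone_image:
  fixes \<pi> :: "'a::real_normed_vector \<Rightarrow> 'b::real_normed_vector"
  assumes "Borsukian S" "continuous_on S \<pi>" "\<pi> ` S = T"
    and "\<And>U. openin (top_of_set S) U \<Longrightarrow> openin (top_of_set T) (\<pi> ` U)"
    and "\<And>y. y \<in> T \<Longrightarrow> connected (S \<inter> \<pi> -` {y})"
  shows "Borsukian T"
  unfolding Borsukian_continuous_logarithm
proof (intro allI impI, elim conjE)
  fix f :: "'b \<Rightarrow> complex" assume f: "continuous_on T f" "f \<in> T \<rightarrow> - {0}"
  have "continuous_on S (f \<circ> \<pi>)"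
    using continuous_on_compose[OF assms(2)] f(1) assms(3) by blast
  moreover have "f \<circ> \<pi> \<in> S \<rightarrow> - {0}"
    using f(2) assms(3) by auto
  ultimately obtain L where L: "continuous_on S L" "\<And>x. x \<in> S \<Longrightarrow> f (\<pi> x) = exp (L x)"
    using assms(1) unfolding Borsukian_continuous_logarithm by (metis comp_apply)
  obtain g where "continuous_on T g" "\<And>y. y \<in> T \<Longrightarrow> exp (g y) = f y"
    using continuous_logarithm_descends[OF assms(3-5) L(1), of f] L(2) by metis
  then show "\<exists>g. continuous_on T g \<and> (\<forall>x\<in>T. f x = exp (g x))"
    by metis
qed

text \<open>Needed to restrict the pencil projection to the part of the set lying over the unit
  circle.\<close>

lemma openin_image_restrict_preimage:
  assumes "\<And>U. openin (top_of_set S) U \<Longrightarrow> openin (top_of_set T) (\<pi> ` U)"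
    and "openin (top_of_set (S \<inter> \<pi> -` K)) U" "K \<subseteq> T"
  shows "openin (top_of_set K) (\<pi> ` U)"
proof -
  obtain V where V: "open V" "U = S \<inter> \<pi> -` K \<inter> V"
    using assms(2) unfolding openin_open by auto
  obtain V' where V': "open V'" "\<pi> ` (S \<inter> V) = T \<inter> V'"
    using assms(1)[OF openin_open_Int[OF V(1)]] unfolding openin_open by auto
  have "\<pi> ` U = K \<inter> \<pi> ` (S \<inter> V)"
    using V(2) by auto
  also have "\<dots> = K \<inter> V'"
    using V'(2) assms(3) by blast
  finally have "\<pi> ` U = K \<inter> V'" .
  then show ?thesis
    using V'(1) by (metis openin_open)
qed

text \<open>Bisection reduces the rectangle to pieces so small that \<open>loc\<close> applies. Two
  neighbouring pieces glue because an open map with connected fibres pulls their convex intersection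
  back to a connected set.\<close>

lemma Borsukian_fibred_over_rectangle:
  fixes \<pi> :: "'a::real_normed_vector \<Rightarrow> complex"
  assumes cont: "continuous_on S \<pi>" and surj: "\<pi> ` S = UNIV"
    and ope: "\<And>U. openin (top_of_set S) U \<Longrightarrow> openin (top_of_set UNIV) (\<pi> ` U)"
    and conn: "\<And>y. connected (S \<inter> \<pi> -` {y})"
    and loc: "\<And>p. \<exists>d>0. \<forall>K. convex K \<and> K \<subseteq> ball p d \<longrightarrow> Borsukian (S \<inter> \<pi> -` K)"
    and le: "x1 \<le> x2" "y1 \<le> y2"
  shows "Borsukian (S \<inter> \<pi> -` cbox (Complex x1 y1) (Complex x2 y2))"
proof -
  have glue: "Borsukian (S \<inter> \<pi> -` (K1 \<union> K2))"
    if "closed K1" "closed K2" "convex K1" "convex K2"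
      "Borsukian (S \<inter> \<pi> -` K1)" "Borsukian (S \<inter> \<pi> -` K2)" for K1 K2
  proof -
    have cl: "closedin (top_of_set (S \<inter> \<pi> -` (K1 \<union> K2))) (S \<inter> \<pi> -` K)"
      if "closed K" "K \<subseteq> K1 \<union> K2" for K
    proof -
      have "closedin (top_of_set (S \<inter> \<pi> -` (K1 \<union> K2))) (S \<inter> \<pi> -` (K1 \<union> K2) \<inter> \<pi> -` K)"
        by (rule continuous_closedin_preimage[OF continuous_on_subset[OF cont] that(1)]) auto
      moreover have "S \<inter> \<pi> -` (K1 \<union> K2) \<inter> \<pi> -` K = S \<inter> \<pi> -` K"
        using that(2) by auto
      ultimately show ?thesis by simp
    qed
    have un: "S \<inter> \<pi> -` (K1 \<union> K2) = (S \<inter> \<pi> -` K1) \<union> (S \<inter> \<pi> -` K2)"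
      by auto
    have "connected (S \<inter> \<pi> -` (K1 \<inter> K2))"
      by (rule connected_open_monotone_preimage[OF cont surj ope conn
          convex_connected[OF convex_Int[OF that(3,4)]] subset_UNIV])
    moreover have "S \<inter> \<pi> -` (K1 \<inter> K2) = (S \<inter> \<pi> -` K1) \<inter> (S \<inter> \<pi> -` K2)"
      by auto
    ultimately show ?thesis
      using cl[OF that(1)] cl[OF that(2)] that(5,6) unfolding un
      by (intro Borsukian_closed_Un) auto
  qed
  define R where "R \<equiv> \<lambda>a b c d. cbox (Complex a c) (Complex b d)"
  define P where "P \<equiv> \<lambda>a b c d. Borsukian (S \<inter> \<pi> -` R a b c d)"
  have hor: "P a c y y'" if "P a b y y'" "P b c y y'" "a \<le> b" "b \<le> c" for a b c y y'
  proof -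
    have "R a c y y' = R a b y y' \<union> R b c y y'"
      using that(3,4) by (auto simp: R_def in_cbox_complex_iff)
    then show ?thesis
      using glue[of "R a b y y'" "R b c y y'"] that(1,2)
      by (simp add: P_def R_def convex_box closed_cbox)
  qed
  have ver: "P x x' a c" if "P x x' a b" "P x x' b c" "a \<le> b" "b \<le> c" for a b c x x'
  proof -
    have "R x x' a c = R x x' a b \<union> R x x' b c"
      using that(3,4) by (auto simp: R_def in_cbox_complex_iff)
    then show ?thesis
      using glue[of "R x x' a b" "R x x' b c"] that(1,2)
      by (simp add: P_def R_def convex_box closed_cbox)
  qed
  have loc': "\<exists>e>0. \<forall>a b c d. a \<le> x \<and> x \<le> b \<and> b - a < e \<and> c \<le> y \<and> y \<le> d \<and> d - c < e \<longrightarrow> P a b c d"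
    for x y
  proof -
    obtain e where e: "e > 0" "\<And>K. convex K \<Longrightarrow> K \<subseteq> ball (Complex x y) e \<Longrightarrow> Borsukian (S \<inter> \<pi> -` K)"
      using loc by metis
    have "P a b c d" if "a \<le> x" "x \<le> b" "b - a < e/2" "c \<le> y" "y \<le> d" "d - c < e/2" for a b c d
      unfolding P_def
    proof (rule e(2))
      show "convex (R a b c d)"
        by (simp add: R_def convex_box)
      show "R a b c d \<subseteq> ball (Complex x y) e"
      proof
        fix p assume p: "p \<in> R a b c d"
        have "cmod (Complex x y - p) \<le> \<bar>Re (Complex x y - p)\<bar> + \<bar>Im (Complex x y - p)\<bar>"
          by (rule cmod_le)
        also have "\<dots> < e"
          using p that by (auto simp: R_def in_cbox_complex_iff)
        finally show "p \<in> ball (Complex x y) e"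
          by (simp add: dist_norm)
      qed
    qed
    then show ?thesis
      using e(1) by (intro exI[of _ "e/2"]) auto
  qed
  have "P x1 x2 y1 y2"
    using le(1)
  proof (induction rule: Bolzano)
    case (trans a b c)
    then show ?case using hor by blast
  next
    case (local x)
    \<comment> \<open>Bisection in the second coordinate yields a single width \<open>e\<close>
      valid for the full height of the rectangle, which is what bisection in the first coordinate
      asks for.\<close>
    have "\<exists>e>0. \<forall>a b. a \<le> x \<and> x \<le> b \<and> b - a < e \<longrightarrow> P a b y1 y2"
      using le(2)
    proof (induction rule: Bolzano)
      case (trans a b c)
      then obtain e e' where "e > 0" "e' > 0"
        "\<forall>s t. s \<le> x \<and> x \<le> t \<and> t - s < e \<longrightarrow> P s t a b"
        "\<forall>s t. s \<le> x \<and> x \<le> t \<and> t - s < e' \<longrightarrow> P s t b c"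
        by blast
      then have "0 < min e e'" "\<forall>s t. s \<le> x \<and> x \<le> t \<and> t - s < min e e' \<longrightarrow> P s t a c"
        using trans(3,4) by (auto intro: ver[of _ _ a b c])
      then show ?case
        by blast
    next
      case (local y)
      obtain e where "e > 0"
        "\<forall>a b c d. a \<le> x \<and> x \<le> b \<and> b - a < e \<and> c \<le> y \<and> y \<le> d \<and> d - c < e \<longrightarrow> P a b c d"
        using loc' by blast
      then show ?case
        by (intro exI[of _ e] conjI allI impI) auto
    qed
    then show ?case .
  qed
  then show ?thesis
    by (simp add: P_def R_def)
qed

section \<open>C-convex sets\<close>

lemma linear_vector_scale: "linear (\<lambda>t::complex. t *s (v :: complex ^ 'n))"
  by (rule linearI) (simp_all add: vector_sadd_rdistrib vec_eq_iff algebra_simps)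

lemma continuous_on_vector_scale [continuous_intros]:
  fixes f :: "'a::topological_space \<Rightarrow> complex" and g :: "'a \<Rightarrow> complex ^ 'n"
  assumes "continuous_on S f" "continuous_on S g"
  shows "continuous_on S (\<lambda>x. f x *s g x)"
  unfolding vector_scalar_mult_def
  by (intro continuous_on_vec_lambda continuous_intros assms)

text \<open>The parameters of a slice are homeomorphic to the intersection with the line. In the
  degenerate cases they form the whole plane or the empty set, so no side conditions are
  needed.\<close>

lemma C_convex_slice:
  fixes D :: "(complex ^ 'n) set"
  assumes "open D" "C_convex D"
  shows "open {t. a + t *s v \<in> D}" "simply_connected {t. a + t *s v \<in> D}"
proof -
  let ?T = "{t. a + t *s v \<in> D}"
  have eq: "?T = (\<lambda>t. a + t *s v) -` D" by auto
  show "open ?T"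
    unfolding eq by (intro open_vimage assms continuous_intros)
  show "simply_connected ?T"
  proof (cases "v = 0 \<or> ?T = {}")
    case True
    then have "?T = UNIV \<or> ?T = {}" by auto
    then show ?thesis
      by (auto simp: convex_imp_simply_connected)
  next
    case False
    then have "D \<inter> complex_line a v \<noteq> {}"
      by (auto simp: complex_line_def)
    then have "simply_connected (D \<inter> complex_line a v)"
      using assms(2) False by (auto simp: C_convex_def)
    also have "D \<inter> complex_line a v = (+) a ` ((\<lambda>t. t *s v) ` ?T)"
      by (auto simp: complex_line_def)
    finally have "simply_connected ((+) a ` ((\<lambda>t. t *s v) ` ?T))" .
    moreover have "inj (\<lambda>t::complex. t *s v)"
      using False by (auto intro: injI)
    ultimately show ?thesis
      using linear_homeomorphic_image[OF linear_vector_scale[of v], of ?T]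
        homeomorphic_translation[of "(\<lambda>t. t *s v) ` ?T" a] homeomorphic_simply_connected_eq
      by metis
  qed
qed

text \<open>Two points of the slice are joined inside the complex line through them, which stays in
  \<open>M\<close>; the intersection of \<open>D\<close> with that line is connected.\<close>

lemma C_convex_connected_slice:
  fixes D :: "(complex ^ 'n) set"
  assumes "open D" "C_convex D"
    and M: "\<And>x y t. x \<in> M \<Longrightarrow> y \<in> M \<Longrightarrow> x + t *s (y - x) \<in> M"
  shows "connected (D \<inter> M)"
  unfolding connected_iff_connected_component
proof (intro ballI)
  fix x y assume x: "x \<in> D \<inter> M" and y: "y \<in> D \<inter> M"
  let ?T = "{t. x + t *s (y - x) \<in> D}"
  have "connected ((\<lambda>t. x + t *s (y - x)) ` ?T)"
    by (intro connected_continuous_image continuous_intros simply_connected_imp_connected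
        C_convex_slice(2)[OF assms(1,2)])
  moreover have "(\<lambda>t. x + t *s (y - x)) ` ?T \<subseteq> D \<inter> M"
    using M x y by auto
  moreover have "x \<in> (\<lambda>t. x + t *s (y - x)) ` ?T"
    using x by (intro image_eqI[of _ _ 0]) auto
  moreover have "y \<in> (\<lambda>t. x + t *s (y - x)) ` ?T"
    using y by (intro image_eqI[of _ _ 1]) auto
  ultimately show "connected_component (D \<inter> M) x y"
    unfolding connected_component_def by blast
qed

text \<open>A logarithm is fixed on each slice by its value at the base point \<open>s e\<close>. It is continuous
  across slices since a compact path from \<open>s e\<^sub>0\<close> to \<open>e\<^sub>0\<close> stays in \<open>D\<close> when \<open>e\<^sub>0\<close> is perturbed.\<close>

lemma C_convex_ruled_Borsukian:
  fixes D E :: "(complex ^ 'n) set"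
  assumes D: "open D" "C_convex D" and ED: "E \<subseteq> D"
    and conts: "continuous_on E s" and sE: "Borsukian (s ` E)" "s ` E \<subseteq> E"
    and line: "\<And>e t. e \<in> E \<Longrightarrow> s e + t *s (e - s e) \<in> D \<Longrightarrow> s e + t *s (e - s e) \<in> E"
  shows "Borsukian E"
  unfolding Borsukian_continuous_logarithm
proof (intro allI impI, elim conjE)
  fix f :: "complex ^ 'n \<Rightarrow> complex" assume contf: "continuous_on E f" and "f \<in> E \<rightarrow> - {0}"
  then have nz: "f e \<noteq> 0" if "e \<in> E" for e
    using that by auto
  define ray where "ray \<equiv> \<lambda>e t. s e + t *s (e - s e)"
  define T where "T \<equiv> \<lambda>e. {t. ray e t \<in> D}"
  have rayE: "ray e t \<in> E" if "e \<in> E" "t \<in> T e" for e t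
    using line that by (simp add: ray_def T_def)
  have T01: "0 \<in> T e" "1 \<in> T e" if "e \<in> E" for e
    using that sE(2) ED by (auto simp: T_def ray_def)
  have T: "open (T e)" "simply_connected (T e)" for e
    unfolding T_def ray_def by (rule C_convex_slice[OF D])+
  have contr: "continuous_on A (\<lambda>x. ray (g x) (h x))"
    if "continuous_on A g" "continuous_on A h" "g ` A \<subseteq> E" for A :: "'b::topological_space set" and g h
    unfolding ray_def
    by (intro continuous_intros that continuous_on_compose2[OF conts])
  have contfr: "continuous_on A (\<lambda>x. f (ray (g x) (h x)))"
    if "continuous_on A g" "continuous_on A h" "g ` A \<subseteq> E" "\<And>x. x \<in> A \<Longrightarrow> h x \<in> T (g x)"
    for A :: "'b::topological_space set" and g h
    using rayE that by (intro continuous_on_compose2[OF contf contr[OF that(1-3)]]) auto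
  have "\<exists>G. continuous_on (T e) G \<and> (\<forall>t\<in>T e. f (ray e t) = exp (G t))" if "e \<in> E" for e
  proof -
    have "continuous_on (T e) (\<lambda>t. f (ray e t))"
      using that by (intro contfr continuous_intros) auto
    moreover have "\<forall>t\<in>T e. f (ray e t) \<noteq> 0"
      using that rayE nz by blast
    ultimately show ?thesis
      using T(2)[of e] unfolding simply_connected_eq_continuous_log[OF T(1)] by blast
  qed
  then obtain G where contG: "\<And>e. e \<in> E \<Longrightarrow> continuous_on (T e) (G e)"
    and G: "\<And>e t. e \<in> E \<Longrightarrow> t \<in> T e \<Longrightarrow> f (ray e t) = exp (G e t)"
    by metis
  have "continuous_on (s ` E) f" "f \<in> s ` E \<rightarrow> - {0}"
    using continuous_on_subset[OF contf sE(2)] sE(2) nz by auto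
  then obtain l where contl: "continuous_on (s ` E) l" and l: "\<And>x. x \<in> s ` E \<Longrightarrow> f x = exp (l x)"
    using sE(1) unfolding Borsukian_continuous_logarithm by metis
  \<comment> \<open>The branch \<open>G e\<close> is chosen separately for each \<open>e\<close>,
    but its increment from 0 to 1 does not depend on the choice.\<close>
  define L where "L \<equiv> \<lambda>e. l (s e) + (G e 1 - G e 0)"
  have ray01: "ray e 0 = s e" "ray e 1 = e" for e
    by (simp_all add: ray_def)
  have "f e = exp (L e)" if "e \<in> E" for e
    using G[OF that T01(1)[OF that]] G[OF that T01(2)[OF that]] l[of "s e"] that
    by (simp add: L_def exp_add exp_diff ray01)
  moreover have "continuous_on E L"
    unfolding continuous_on_eq_continuous_within
  proof
    fix e0 assume e0: "e0 \<in> E"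
    have "path_connected (T e0)"
      using T(2) simply_connected_imp_path_connected by blast
    then obtain g where g: "path g" "path_image g \<subseteq> T e0" "pathstart g = 0" "pathfinish g = 1"
      using T01[OF e0] unfolding path_connected_def by blast
    \<comment> \<open>\<open>C\<close> is a compact connected set of parameters joining 0 (the base
      point) to 1 (the point itself). By compactness it stays admissible for all \<open>e\<close>
      near \<open>e0\<close>.\<close>
    define C where "C \<equiv> path_image g"
    have C: "compact C" "connected C" "0 \<in> C" "1 \<in> C" "C \<subseteq> T e0"
      using g compact_path_image connected_path_image pathstart_in_path_image pathfinish_in_path_image
      unfolding C_def by metis+
    have "compact (ray e0 ` C)"
      using e0 by (intro compact_continuous_image C contr continuous_intros) auto
    moreover have "ray e0 ` C \<subseteq> D"
      using C(5) by (auto simp: T_def)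
    ultimately obtain d where d: "d > 0" "(\<Union>x\<in>ray e0 ` C. cball x d) \<subseteq> D"
      using compact_subset_open_imp_cball_epsilon_subset[OF _ D(1)] by blast
    have cont1: "continuous_on (E \<times> C) (\<lambda>z. ray (fst z) (snd z))"
      by (intro contr continuous_intros) auto
    obtain X0 where X0: "e0 \<in> X0" "open X0"
      "\<forall>x\<in>X0 \<inter> E. \<forall>t\<in>C. dist (ray x t) (ray e0 t) \<le> d"
      using continuous_on_prod_compactE[OF cont1 C(1) e0 d(1)] by (metis fst_conv snd_conv)
    have CT: "C \<subseteq> T e" if "e \<in> X0 \<inter> E" for e
    proof
      fix t assume t: "t \<in> C"
      have "dist (ray e0 t) (ray e t) \<le> d"
        using X0(3) that t by (subst dist_commute) blast
      then show "t \<in> T e"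
        using d(2) t by (auto simp: T_def subset_eq)
    qed
    \<comment> \<open>The quotient equals 1 at \<open>e = e0\<close>, so for nearby \<open>e\<close>
      it lies within 1/2 of 1, uniformly on \<open>C\<close>, where the principal logarithm is
      continuous.\<close>
    define r where "r \<equiv> \<lambda>e t. f (ray e t) / f (ray e0 t)"
    have cont2: "continuous_on ((X0 \<inter> E) \<times> C) (\<lambda>z. r (fst z) (snd z))"
      unfolding r_def
    proof (rule continuous_on_divide)
      show "continuous_on ((X0 \<inter> E) \<times> C) (\<lambda>z. f (ray (fst z) (snd z)))"
        using CT[THEN subsetD] by (intro contfr continuous_intros) auto
      show "continuous_on ((X0 \<inter> E) \<times> C) (\<lambda>z. f (ray e0 (snd z)))"
        using C(5) e0 by (intro contfr continuous_intros) auto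
      show "\<forall>z\<in>(X0 \<inter> E) \<times> C. f (ray e0 (snd z)) \<noteq> 0"
        using C(5) nz rayE[OF e0] by auto
    qed
    have contq: "continuous_on A (\<lambda>x. r (g x) (h x))"
      if "continuous_on A g" "continuous_on A h" "g ` A \<subseteq> X0 \<inter> E" "h ` A \<subseteq> C"
      for A :: "'c::topological_space set" and g h
      using continuous_on_compose2[OF cont2 continuous_on_Pair[OF that(1,2)]] that(3,4)
      by (force simp: subset_eq)
    obtain X1 where X1: "e0 \<in> X1" "open X1"
      "\<forall>x\<in>X1 \<inter> (X0 \<inter> E). \<forall>t\<in>C. dist (r x t) (r e0 t) \<le> 1/2"
      using continuous_on_prod_compactE[OF cont2 C(1), of e0 "1/2"] e0 X0(1)
      by (metis fst_conv snd_conv IntI half_gt_zero zero_less_one)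
    define N where "N \<equiv> X1 \<inter> X0 \<inter> E"
    have slit: "r e t \<notin> \<real>\<^sub>\<le>\<^sub>0" if "e \<in> N" "t \<in> C" for e t
    proof -
      have "f (ray e0 t) \<noteq> 0"
        using that C(5) by (intro nz rayE[OF e0]) auto
      then have "r e0 t = 1"
        by (simp add: r_def)
      moreover have "dist (r e t) (r e0 t) \<le> 1/2"
        using X1(3) that unfolding N_def by blast
      ultimately have "cmod (r e t - 1) \<le> 1/2"
        by (simp add: dist_norm)
      then have "\<bar>Re (r e t - 1)\<bar> \<le> 1/2"
        using abs_Re_le_cmod order_trans by blast
      then show ?thesis
        by (auto simp: complex_nonpos_Reals_iff)
    qed
    \<comment> \<open>Along \<open>C\<close> the branches \<open>G e\<close> and \<open>G e0\<close>
      plus the principal logarithm of \<open>r e\<close> differ by a logarithm of 1, hence by a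
      constant. This replaces \<open>G e\<close> by terms that depend continuously on
      \<open>e\<close>.\<close>
    have L: "L e = l (s e) + (G e0 1 - G e0 0) + (Ln (r e 1) - Ln (r e 0))" if e: "e \<in> N" for e
    proof -
      have eE: "e \<in> E" "C \<subseteq> T e"
        using e CT by (auto simp: N_def)
      define h where "h \<equiv> \<lambda>t. G e t - G e0 t - Ln (r e t)"
      have "continuous_on C (r e)"
        using e by (intro contq continuous_intros) (auto simp: N_def)
      then have "continuous_on C h"
        unfolding h_def using slit[OF e] eE C(5)
        by (intro continuous_intros continuous_on_subset[OF contG] e0) auto
      moreover have "exp (h t) = 1" if "t \<in> C" for t
      proof -
        have "r e t \<noteq> 0"
          using slit[OF e that] by auto
        moreover have "r e t = exp (G e t) / exp (G e0 t)"
          using G[OF e0 subsetD[OF C(5) that]] G[OF eE(1) subsetD[OF eE(2) that]]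
          by (simp add: r_def)
        ultimately show ?thesis
          by (simp add: h_def exp_diff)
      qed
      ultimately have "h constant_on C"
        using exp_constant_imp_constant_on[OF C(2)] by blast
      then have "h 0 = h 1"
        using C(3,4) unfolding constant_on_def by metis
      then show ?thesis
        by (simp add: L_def h_def algebra_simps)
    qed
    have "continuous_on N (\<lambda>e. l (s e) + (G e0 1 - G e0 0) + (Ln (r e 1) - Ln (r e 0)))"
    proof (intro continuous_intros continuous_on_compose2[OF contl] continuous_on_subset[OF conts])
      have "continuous_on N (\<lambda>e. r e t)" if "t \<in> C" for t
        using that by (intro contq continuous_intros) (auto simp: N_def)
      then show "continuous_on N (\<lambda>e. r e 1)" "continuous_on N (\<lambda>e. r e 0)"
        using C(3,4) by blast+
    qed (use slit C(3,4) in \<open>auto simp: N_def\<close>)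
    then have "continuous_on N L"
      by (rule continuous_on_eq) (simp add: L)
    moreover have "e0 \<in> N"
      using e0 X0(1) X1(1) by (simp add: N_def)
    ultimately have "continuous (at e0 within N) L"
      by (simp add: continuous_on_eq_continuous_within)
    moreover have "at e0 within N = at e0 within E"
      by (rule at_within_nhd[of _ "X1 \<inter> X0"]) (use X0 X1 in \<open>auto simp: N_def\<close>)
    ultimately show "continuous (at e0 within E) L"
      by simp
  qed
  ultimately show "\<exists>g. continuous_on E g \<and> (\<forall>x\<in>E. f x = exp (g x))"
    by blast
qed

section \<open>Hyperplanes missing a C-convex set\<close>

text \<open>The pairing carries no complex conjugation: it is complex linear in both arguments, so
  forms can be combined like vectors.\<close>

definition linear_form :: "complex ^ 'n \<Rightarrow> complex ^ 'n \<Rightarrow> complex" where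
  "linear_form a x = (\<Sum>i\<in>UNIV. a $ i * x $ i)"

lemma linear_form_simps [simp]:
  "linear_form a (x + y) = linear_form a x + linear_form a y"
  "linear_form a (x - y) = linear_form a x - linear_form a y"
  "linear_form a (c *s x) = c * linear_form a x"
  "linear_form (a - b) x = linear_form a x - linear_form b x"
  "linear_form (c *s a) x = c * linear_form a x"
  by (simp_all add: linear_form_def algebra_simps sum.distrib sum_subtractf sum_distrib_left)

lemma linear_form_axis: "linear_form (axis i 1) x = x $ i"
proof -
  have "axis i 1 $ j * x $ j = (if j = i then x $ j else 0)" for j
    by (simp add: axis_def)
  then show ?thesis
    by (simp add: linear_form_def)
qed

lemma continuous_on_linear_form [continuous_intros]:
  "continuous_on S f \<Longrightarrow> continuous_on S (\<lambda>x. linear_form a (f x))"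
  unfolding linear_form_def by (intro continuous_intros)

text \<open>The pencil consists of the hyperplanes \<open>b = p a\<close> in \<open>W\<close>; \<open>\<pi>\<close> sends a point of \<open>D \<inter> W\<close> to
  the parameter \<open>p\<close> of its hyperplane, and the direction \<open>u\<close> moves points across the pencil.\<close>

context
  fixes D W :: "(complex ^ 'n) set" and a b u :: "complex ^ 'n"
    and S :: "(complex ^ 'n) set" and \<pi> :: "complex ^ 'n \<Rightarrow> complex"
  assumes D: "open D" "C_convex D"
    and W: "\<And>x y. x \<in> W \<Longrightarrow> y \<in> W \<Longrightarrow> x + y \<in> W" "\<And>x y. x \<in> W \<Longrightarrow> y \<in> W \<Longrightarrow> x - y \<in> W"
      "\<And>c x. x \<in> W \<Longrightarrow> c *s x \<in> W"
    and ab: "\<And>e. e \<in> D \<Longrightarrow> e \<in> W \<Longrightarrow> linear_form a e \<noteq> 0 \<or> linear_form b e \<noteq> 0"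
    and u: "u \<in> W" "linear_form a u = 0" "linear_form b u = 1"
    and hit: "\<And>p. \<exists>e\<in>D \<inter> W. linear_form b e = p * linear_form a e"
    and S_def: "S = {e \<in> D \<inter> W. linear_form a e \<noteq> 0}"
    and \<pi>_def: "\<pi> = (\<lambda>e. linear_form b e / linear_form a e)"
begin

lemma pencil_continuous: "continuous_on S \<pi>"
  unfolding \<pi>_def S_def by (intro continuous_intros) auto

text \<open>The condition that \<open>a\<close> is nonzero disappears on the right: if
  \<open>a\<close> vanished there, so would \<open>b\<close>, against \<open>ab\<close>. Thus each
  fibre is a slice of \<open>D\<close> by a linear subspace.\<close>

lemma pencil_fibre: "S \<inter> \<pi> -` {p} = D \<inter> {e \<in> W. linear_form b e = p * linear_form a e}"
  using ab by (fastforce simp: S_def \<pi>_def divide_simps)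

lemma pencil_surj: "\<pi> ` S = UNIV"
proof -
  have "p \<in> \<pi> ` S" for p
  proof -
    have "S \<inter> \<pi> -` {p} \<noteq> {}"
      using hit[of p] unfolding pencil_fibre by auto
    then show ?thesis
      by auto
  qed
  then show ?thesis by blast
qed

lemma pencil_connected: "connected (S \<inter> \<pi> -` {p})"
  unfolding pencil_fibre
  by (rule C_convex_connected_slice[OF D]) (auto simp: W algebra_simps)

lemma pencil_section:
  assumes "e \<in> S" "open V" "e \<in> V"
  obtains x d where "d > 0" "x = (\<lambda>p. e + ((p - \<pi> e) * linear_form a e) *s u)"
    "\<And>p. p \<in> ball (\<pi> e) d \<Longrightarrow> x p \<in> S \<inter> V" "\<And>p. p \<in> ball (\<pi> e) d \<Longrightarrow> \<pi> (x p) = p"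
    "\<And>p. linear_form a (x p) = linear_form a e"
proof -
  define x where "x \<equiv> \<lambda>p. e + ((p - \<pi> e) * linear_form a e) *s u"
  have e: "e \<in> D" "e \<in> W" "linear_form a e \<noteq> 0"
    using assms(1) by (auto simp: S_def)
  have "open (x -` (D \<inter> V))"
    unfolding x_def by (intro open_vimage open_Int D assms continuous_intros)
  moreover have "x (\<pi> e) = e"
    by (simp add: x_def)
  ultimately obtain d where d: "d > 0" "ball (\<pi> e) d \<subseteq> x -` (D \<inter> V)"
    using e assms(3) unfolding open_contains_ball by (metis IntI vimageI)
  have a: "linear_form a (x p) = linear_form a e" for p
    using u by (simp add: x_def)
  have "\<pi> (x p) = p" for p
    using u e(3) by (simp add: x_def \<pi>_def field_simps)
  moreover have "x p \<in> W" for p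
    unfolding x_def by (intro W e u)
  moreover have "x p \<in> S \<inter> V" if "p \<in> ball (\<pi> e) d" for p
    using subsetD[OF d(2) that] \<open>x p \<in> W\<close> a e(3) by (auto simp: S_def)
  ultimately show ?thesis
    using that[of d x] d(1) a x_def by blast
qed

lemma pencil_open:
  assumes "openin (top_of_set S) U"
  shows "openin (top_of_set UNIV) (\<pi> ` U)"
proof -
  obtain V where V: "open V" "U = S \<inter> V"
    using assms unfolding openin_open by auto
  have "\<exists>d>0. ball p d \<subseteq> \<pi> ` U" if "p \<in> \<pi> ` U" for p
  proof -
    obtain e where e: "e \<in> S" "e \<in> V" "p = \<pi> e"
      using \<open>p \<in> \<pi> ` U\<close> V(2) by auto
    obtain x d where "d > 0"
      "\<And>p. p \<in> ball (\<pi> e) d \<Longrightarrow> x p \<in> S \<inter> V" "\<And>p. p \<in> ball (\<pi> e) d \<Longrightarrow> \<pi> (x p) = p"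
      using pencil_section[OF e(1) V(1) e(2)] by metis
    then show ?thesis
      using e(3) V(2) by (metis image_eqI subsetI)
  qed
  then show ?thesis
    by (simp add: open_contains_ball)
qed

text \<open>Over a small convex \<open>K\<close> the affine section \<open>x\<close> has convex
  image, and each fibre is ruled by complex lines through its section point. So
  \<open>C_convex_ruled_Borsukian\<close> applies with the section as base.\<close>

lemma pencil_local_Borsukian: "\<exists>d>0. \<forall>K. convex K \<and> K \<subseteq> ball p d \<longrightarrow> Borsukian (S \<inter> \<pi> -` K)"
proof -
  obtain e where e: "e \<in> S" "\<pi> e = p"
    using pencil_surj by (metis UNIV_I imageE)
  obtain x d where d: "d > 0" and x_def: "x = (\<lambda>p. e + ((p - \<pi> e) * linear_form a e) *s u)"
    and x: "\<And>p. p \<in> ball (\<pi> e) d \<Longrightarrow> x p \<in> S \<inter> UNIV"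
      "\<And>p. p \<in> ball (\<pi> e) d \<Longrightarrow> \<pi> (x p) = p"
    using pencil_section[OF e(1) open_UNIV UNIV_I] by metis
  have "Borsukian (S \<inter> \<pi> -` K)" if K: "convex K" "K \<subseteq> ball p d" for K
  proof -
    let ?E = "S \<inter> \<pi> -` K"
    have xK: "x q \<in> S" "\<pi> (x q) = q" if "q \<in> K" for q
      using x that K(2) e(2) by blast+
    have im: "(\<lambda>y. x (\<pi> y)) ` ?E = x ` K"
    proof
      show "x ` K \<subseteq> (\<lambda>y. x (\<pi> y)) ` ?E"
      proof
        fix y assume "y \<in> x ` K"
        then obtain q where q: "q \<in> K" "y = x q" by blast
        then show "y \<in> (\<lambda>y. x (\<pi> y)) ` ?E"
          using xK[OF q(1)] by (intro image_eqI[of _ _ "x q"]) auto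
      qed
    qed auto
    have "x ` K = (\<lambda>t. (e - (\<pi> e * linear_form a e) *s u) + t) ` ((\<lambda>t. t *s (linear_form a e *s u)) ` K)"
      by (simp add: image_image x_def algebra_simps)
    then have "convex (x ` K)"
      using K(1) by (metis convex_linear_image convex_translation linear_vector_scale)
    then have "Borsukian (x ` K)"
      by (rule convex_imp_Borsukian)
    show ?thesis
    proof (rule C_convex_ruled_Borsukian[OF D, where s = "\<lambda>y. x (\<pi> y)"])
      show "?E \<subseteq> D"
        by (auto simp: S_def)
      show "continuous_on ?E (\<lambda>y. x (\<pi> y))"
        unfolding x_def
        by (intro continuous_intros continuous_on_subset[OF pencil_continuous]) auto
      show "Borsukian ((\<lambda>y. x (\<pi> y)) ` ?E)"
        unfolding im by fact
      show "(\<lambda>y. x (\<pi> y)) ` ?E \<subseteq> ?E"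
        unfolding im using xK by auto
      fix y t assume y: "y \<in> ?E" and t: "x (\<pi> y) + t *s (y - x (\<pi> y)) \<in> D"
      let ?q = "\<pi> y"
      have "x ?q \<in> S \<inter> \<pi> -` {?q}" "y \<in> S \<inter> \<pi> -` {?q}"
        using xK[of ?q] y by auto
      then have "x ?q + t *s (y - x ?q) \<in> S \<inter> \<pi> -` {?q}"
        using t unfolding pencil_fibre by (simp add: W algebra_simps)
      then show "x ?q + t *s (y - x ?q) \<in> ?E"
        using y by auto
    qed
  qed
  then show ?thesis
    using d by blast
qed

lemma pencil_Borsukian:
  assumes "x1 \<le> x2" "y1 \<le> y2"
  shows "Borsukian (S \<inter> \<pi> -` cbox (Complex x1 y1) (Complex x2 y2))"
  by (rule Borsukian_fibred_over_rectangle[OF pencil_continuous pencil_surj pencil_open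
      pencil_connected pencil_local_Borsukian assms])

text \<open>Gluing was done over rectangles, so the logarithm is taken over a square containing the
  closed disc and then restricted.\<close>

lemma pencil_logarithm:
  obtains L where "continuous_on (S \<inter> \<pi> -` cball 0 1) L"
    "\<And>e. e \<in> S \<inter> \<pi> -` cball 0 1 \<Longrightarrow> linear_form a e = exp (L e)"
proof -
  let ?Q = "cbox (Complex (-1) (-1)) (Complex 1 1)"
  have "continuous_on (S \<inter> \<pi> -` ?Q) (linear_form a)" "linear_form a \<in> S \<inter> \<pi> -` ?Q \<rightarrow> - {0}"
    using continuous_on_linear_form[OF continuous_on_id] by (auto simp: S_def)
  then obtain L where L: "continuous_on (S \<inter> \<pi> -` ?Q) L"
    "\<And>e. e \<in> S \<inter> \<pi> -` ?Q \<Longrightarrow> linear_form a e = exp (L e)"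
    using pencil_Borsukian[of "-1" 1 "-1" 1] unfolding Borsukian_continuous_logarithm by auto
  have "cball 0 1 \<subseteq> ?Q"
  proof
    fix p :: complex assume "p \<in> cball 0 1"
    then have "\<bar>Re p\<bar> \<le> 1" "\<bar>Im p\<bar> \<le> 1"
      using abs_Re_le_cmod[of p] abs_Im_le_cmod[of p] by simp_all
    then show "p \<in> ?Q"
      by (auto simp: in_cbox_complex_iff abs_le_iff)
  qed
  then have "S \<inter> \<pi> -` cball 0 1 \<subseteq> S \<inter> \<pi> -` ?Q"
    by blast
  then show ?thesis
    using that[of L] L continuous_on_subset by blast
qed

end

text \<open>Otherwise the pencils \<open>b = p a\<close> and \<open>a = p b\<close> both meet
  \<open>D\<close> in every member. They give logarithms of \<open>a\<close> and \<open>b\<close>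
  over the two closed discs that make up the projective line of parameters, and these discs share
  the unit circle.\<close>

lemma C_convex_pencil_misses:
  fixes D W :: "(complex ^ 'n) set"
  assumes D: "open D" "C_convex D"
    and W: "\<And>x y. x \<in> W \<Longrightarrow> y \<in> W \<Longrightarrow> x + y \<in> W" "\<And>x y. x \<in> W \<Longrightarrow> y \<in> W \<Longrightarrow> x - y \<in> W"
      "\<And>c x. x \<in> W \<Longrightarrow> c *s x \<in> W"
    and ab: "\<And>e. e \<in> D \<Longrightarrow> e \<in> W \<Longrightarrow> linear_form a e \<noteq> 0 \<or> linear_form b e \<noteq> 0"
  shows "\<exists>s t. \<forall>e\<in>D \<inter> W. s * linear_form a e \<noteq> t * linear_form b e"
proof (rule ccontr)
  assume "\<not> ?thesis"
  then have hit: "\<exists>e\<in>D \<inter> W. s * linear_form a e = t * linear_form b e" for s t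
    by blast
  have hit': "\<exists>e\<in>D \<inter> W. linear_form b e = p * linear_form a e"
    "\<exists>e\<in>D \<inter> W. linear_form a e = p * linear_form b e" for p
    using hit[of p 1] hit[of 1 p] by (metis mult_1)+
  \<comment> \<open>A point of \<open>D\<close> on the member \<open>a = 0\<close> has nonzero
    \<open>b\<close> by \<open>ab\<close>; rescaled, it is the direction across the pencil.\<close>
  obtain e where e: "e \<in> D \<inter> W" "linear_form a e = 0"
    using hit'(2)[of 0] by auto
  define u where "u = (1 / linear_form b e) *s e"
  have u: "u \<in> W" "linear_form a u = 0" "linear_form b u = 1"
    using e ab[of e] W(3) by (auto simp: u_def)
  obtain e' where e': "e' \<in> D \<inter> W" "linear_form b e' = 0"
    using hit'(1)[of 0] by auto
  define u' where "u' = (1 / linear_form a e') *s e'"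
  have u': "u' \<in> W" "linear_form b u' = 0" "linear_form a u' = 1"
    using e' ab[of e'] W(3) by (auto simp: u'_def)
  have ba: "linear_form b e \<noteq> 0 \<or> linear_form a e \<noteq> 0" if "e \<in> D" "e \<in> W" for e
    using ab that by blast
  define S where "S = {e \<in> D \<inter> W. linear_form a e \<noteq> 0}"
  define \<pi> where "\<pi> = (\<lambda>e. linear_form b e / linear_form a e)"
  define S' where "S' = {e \<in> D \<inter> W. linear_form b e \<noteq> 0}"
  define \<pi>' where "\<pi>' = (\<lambda>e. linear_form a e / linear_form b e)"
  note P = D W ab u hit'(1) S_def \<pi>_def
  obtain L where L: "continuous_on (S \<inter> \<pi> -` cball 0 1) L"
    "\<And>e. e \<in> S \<inter> \<pi> -` cball 0 1 \<Longrightarrow> linear_form a e = exp (L e)"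
    using pencil_logarithm[OF P] by metis
  obtain L' where L': "continuous_on (S' \<inter> \<pi>' -` cball 0 1) L'"
    "\<And>e. e \<in> S' \<inter> \<pi>' -` cball 0 1 \<Longrightarrow> linear_form b e = exp (L' e)"
    using pencil_logarithm[OF D W ba u' hit'(2) S'_def \<pi>'_def] by metis
  \<comment> \<open>Over the unit circle both logarithms exist. Their difference is a logarithm of
    \<pi>, and it descends to a logarithm of the identity on the circle.\<close>
  define C where "C = S \<inter> \<pi> -` sphere 0 1"
  have C: "C \<subseteq> S \<inter> \<pi> -` cball 0 1" "C \<subseteq> S' \<inter> \<pi>' -` cball 0 1"
    by (auto simp: C_def S_def S'_def \<pi>_def \<pi>'_def norm_divide)
  have cont: "continuous_on C (\<lambda>e. L' e - L e)"
    by (intro continuous_intros continuous_on_subset[OF L(1)] continuous_on_subset[OF L'(1)] C)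
  have exp: "exp (L' e - L e) = \<pi> e" if "e \<in> C" for e
    using L(2)[OF subsetD[OF C(1) that]] L'(2)[OF subsetD[OF C(2) that]]
    by (simp add: exp_diff \<pi>_def)
  have "\<pi> ` C = \<pi> ` S \<inter> sphere 0 1"
    by (auto simp: C_def)
  then have im: "\<pi> ` C = sphere 0 1"
    using pencil_surj[OF P] by simp
  have ope: "openin (top_of_set (sphere 0 1)) (\<pi> ` U)" if "openin (top_of_set C) U" for U
    using openin_image_restrict_preimage[OF pencil_open[OF P] that[unfolded C_def] subset_UNIV] .
  have conn: "connected (C \<inter> \<pi> -` {y})" if "y \<in> sphere 0 1" for y
  proof -
    have "C \<inter> \<pi> -` {y} = S \<inter> \<pi> -` {y}"
      using that by (auto simp: C_def)
    then show ?thesis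
      using pencil_connected[OF P] by simp
  qed
  obtain g :: "complex \<Rightarrow> complex"
    where "continuous_on (sphere 0 1) g" "\<And>y. y \<in> sphere 0 1 \<Longrightarrow> exp (g y) = y"
    using continuous_logarithm_descends[OF im ope conn cont exp] by metis
  then show False
    using no_continuous_logarithm_on_circle by blast
qed

text \<open>A set of linear forms without common zero on \<open>D\<close>, of minimal size, is a singleton: by the
  pencil lemma two of its members could be replaced by a single combination.\<close>

lemma C_convex_linear_form_nonzero:
  fixes D :: "(complex ^ 'n) set"
  assumes D: "open D" "C_convex D" and "D \<noteq> {}" "0 \<notin> D"
  shows "\<exists>a. \<forall>x\<in>D. linear_form a x \<noteq> 0"
proof -
  define P where "P \<equiv> \<lambda>A. finite A \<and> (\<forall>x\<in>D. \<exists>a\<in>A. linear_form a x \<noteq> 0)"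
  have "P (range (\<lambda>i. axis i 1))"
    unfolding P_def
  proof (intro conjI ballI)
    fix x assume "x \<in> D"
    then have "x \<noteq> 0"
      using assms(4) by auto
    then obtain i where "x $ i \<noteq> 0"
      by (auto simp: vec_eq_iff)
    then show "\<exists>a\<in>range (\<lambda>i. axis i 1). linear_form a x \<noteq> 0"
      by (auto simp: linear_form_axis)
  qed simp
  then obtain A where A: "P A" and min: "\<And>B. P B \<Longrightarrow> card A \<le> card B"
    using ex_has_least_nat[of P _ card] by blast
  have fin: "finite A"
    using A by (simp add: P_def)
  have "a = b" if "a \<in> A" "b \<in> A" for a b
  proof (rule ccontr)
    assume "a \<noteq> b"
    define R where "R = A - {a, b}"
    define W where "W = {x. \<forall>r\<in>R. linear_form r x = 0}"
    have ab: "linear_form a e \<noteq> 0 \<or> linear_form b e \<noteq> 0" if "e \<in> D" "e \<in> W" for e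
      using A that unfolding P_def W_def R_def by blast
    have W: "\<And>x y. x \<in> W \<Longrightarrow> y \<in> W \<Longrightarrow> x + y \<in> W"
      "\<And>x y. x \<in> W \<Longrightarrow> y \<in> W \<Longrightarrow> x - y \<in> W" "\<And>c x. x \<in> W \<Longrightarrow> c *s x \<in> W"
      by (simp_all add: W_def)
    obtain s t where st: "\<forall>e\<in>D \<inter> W. s * linear_form a e \<noteq> t * linear_form b e"
      using C_convex_pencil_misses[OF D W ab] by blast
    define c where "c = s *s a - t *s b"
    have "P (insert c R)"
      unfolding P_def
    proof (intro conjI ballI)
      show "finite (insert c R)"
        using fin by (simp add: R_def)
      fix x assume "x \<in> D"
      then show "\<exists>r\<in>insert c R. linear_form r x \<noteq> 0"
        using st by (cases "x \<in> W") (auto simp: c_def W_def)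
    qed
    then have "card A \<le> card (insert c R)"
      by (rule min)
    also have "\<dots> \<le> Suc (card R)"
      using fin by (intro card_insert_le_m1) (auto simp: R_def)
    \<comment> \<open>Because subtraction is truncated, the chain only gives
      \<open>card A < 2\<close>; the two distinct members exclude that.\<close>
    also have "card R = card A - 2"
      using fin that \<open>a \<noteq> b\<close> by (simp add: R_def card_Diff_subset)
    finally have "card A < 2" by simp
    moreover have "card {a, b} \<le> card A"
      using fin that by (intro card_mono) auto
    ultimately show False
      using \<open>a \<noteq> b\<close> by simp
  qed
  moreover obtain a where "a \<in> A"
    using A assms(3) unfolding P_def by blast
  ultimately have "A = {a}"
    by blast
  then show ?thesis
    using A unfolding P_def by blast
qed

lemma C_convex_translation:
  fixes D :: "(complex ^ 'n) set"
  assumes "C_convex D"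
  shows "C_convex ((+) w ` D)"
  unfolding C_convex_def
proof (intro allI impI)
  fix a v :: "complex ^ 'n" assume v: "v \<noteq> 0" and ne: "(+) w ` D \<inter> complex_line a v \<noteq> {}"
  have "w + (a - w + t *s v) = a + t *s v" for t
    by simp
  then have "complex_line a v = (+) w ` complex_line (a - w) v"
    by (simp add: complex_line_def image_image)
  then have eq: "(+) w ` D \<inter> complex_line a v = (+) w ` (D \<inter> complex_line (a - w) v)"
    by (simp add: image_Int)
  then have "D \<inter> complex_line (a - w) v \<noteq> {}"
    using ne by auto
  then have "simply_connected (D \<inter> complex_line (a - w) v)"
    using assms v unfolding C_convex_def by blast
  then show "simply_connected ((+) w ` D \<inter> complex_line a v)"
    unfolding eq by (rule homeomorphic_simply_connected[OF homeomorphic_translation])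
qed

text \<open>Translating \<open>w\<close> to the origin turns the affine hyperplane into the kernel
  of a linear form.\<close>

lemma C_convex_supporting_hyperplane:
  fixes D :: "(complex ^ 'n) set"
  assumes "open D" "C_convex D" "D \<noteq> {}" "w \<notin> D"
  obtains a where "\<And>x. x \<in> D \<Longrightarrow> linear_form a (x - w) \<noteq> 0"
proof -
  have "\<exists>a. \<forall>x\<in>(+) (- w) ` D. linear_form a x \<noteq> 0"
    using assms by (intro C_convex_linear_form_nonzero open_translation C_convex_translation) auto
  then show ?thesis
    using that by auto
qed

section \<open>Plane images of C-convex domains under linear forms\<close>

lemma linear_linear_form: "linear (linear_form a)"
proof (rule linearI)
  show "linear_form a (r *\<^sub>R x) = r *\<^sub>R linear_form a x" for r x
    by (simp add: linear_form_def scaleR_sum_right)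
qed simp

text \<open>The complex lines through one fixed point rule all of \<open>D\<close>, so the base of
  the ruling is a single point.\<close>

lemma C_convex_Borsukian:
  fixes D :: "(complex ^ 'n) set"
  assumes "open D" "C_convex D"
  shows "Borsukian D"
proof (cases "D = {}")
  case False
  then obtain z where "z \<in> D" by blast
  then have im: "(\<lambda>_. z) ` D = {z}" by blast
  show ?thesis
    by (rule C_convex_ruled_Borsukian[OF assms order_refl, where s = "\<lambda>_. z"])
      (use \<open>z \<in> D\<close> im in \<open>auto intro: convex_imp_Borsukian\<close>)
qed (simp add: Borsukian_empty)

text \<open>A nonzero form is an open map whose fibres in \<open>D\<close> are connected slices, so
  the logarithms on \<open>D\<close> descend to the image. For open connected plane sets, Borsukian
  and simply connected coincide.\<close>

lemma C_convex_linear_form_image: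
  fixes D :: "(complex ^ 'n) set"
  assumes D: "open D" "C_convex D" "connected D" and u: "linear_form a u \<noteq> 0"
  shows "open (linear_form a ` D)" "simply_connected (linear_form a ` D)"
proof -
  have "y = linear_form a ((y / linear_form a u) *s u)" for y
    using u by simp
  then have surj: "surj (linear_form a)"
    by (metis surj_def)
  have op: "open (linear_form a ` U)" if "open U" for U
    by (rule open_surjective_linear_image[OF that linear_linear_form surj])
  then show "open (linear_form a ` D)"
    using D(1) .
  moreover have "connected (linear_form a ` D)"
    using D(3) by (intro connected_continuous_image continuous_intros)
  moreover have "Borsukian (linear_form a ` D)"
  proof (rule Borsukian_open_monotone_image[OF C_convex_Borsukian[OF D(1,2)] _ refl])
    show "continuous_on D (linear_form a)"
      using continuous_on_linear_form[OF continuous_on_id] .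
    show "openin (top_of_set (linear_form a ` D)) (linear_form a ` U)"
      if "openin (top_of_set D) U" for U
    proof -
      have "open U" "U \<subseteq> D"
        using that openin_open_eq[OF D(1)] by auto
      then show ?thesis
        by (intro open_subset op image_mono)
    qed
    show "connected (D \<inter> linear_form a -` {y})" for y
      by (rule C_convex_connected_slice[OF D(1,2)]) auto
  qed
  ultimately show "simply_connected (linear_form a ` D)"
    using simply_connected_eq_Borsukian by blast
qed

section \<open>Area and injective Bieberbach-Eilenberg functions\<close>

definition complex_of_vec :: "real ^ 2 \<Rightarrow> complex" where
  "complex_of_vec x = Complex (x $ 1) (x $ 2)"

definition vec_of_complex :: "complex \<Rightarrow> real ^ 2" where
  "vec_of_complex z = vector [Re z, Im z]"

lemma vec_of_complex_nth [simp]: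
  "vec_of_complex z $ 1 = Re z" "vec_of_complex z $ 2 = Im z"
  by (simp_all add: vec_of_complex_def)

lemma complex_of_vec_simps [simp]:
  "Re (complex_of_vec x) = x $ 1" "Im (complex_of_vec x) = x $ 2"
  by (simp_all add: complex_of_vec_def)

lemma vec_of_complex_inverse [simp]: "complex_of_vec (vec_of_complex z) = z"
  by (simp add: complex_eq_iff)

lemma complex_of_vec_inverse [simp]: "vec_of_complex (complex_of_vec x) = x"
  by (simp add: vec_eq_iff forall_2)

lemma bounded_linear_complex_of_vec: "bounded_linear complex_of_vec"
  by (rule linear_conv_bounded_linear[THEN iffD1], rule linearI) (simp_all add: complex_eq_iff)

lemma bounded_linear_vec_of_complex: "bounded_linear vec_of_complex"
  by (rule linear_conv_bounded_linear[THEN iffD1], rule linearI)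
    (simp_all add: vec_eq_iff forall_2)

lemma mem_cbox_vec2: "x \<in> cbox (u :: real ^ 2) v \<longleftrightarrow> u $ 1 \<le> x $ 1 \<and> x $ 1 \<le> v $ 1 \<and> u $ 2 \<le> x $ 2 \<and> x $ 2 \<le> v $ 2"
  by (auto simp: mem_box_cart forall_2)

lemma content_cbox_vec2:
  fixes u v :: "real ^ 2"
  assumes "u $ 1 \<le> v $ 1" "u $ 2 \<le> v $ 2"
  shows "measure lborel (cbox u v) = (v $ 1 - u $ 1) * (v $ 2 - u $ 2)"
proof -
  have "cbox u v \<noteq> {}"
    using assms by (auto simp: mem_cbox_vec2 intro!: exI[of _ u])
  then show ?thesis
    by (simp add: content_cbox_cart UNIV_2)
qed

text \<open>Iterated integration takes place on pairs and change of variables on vectors; the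
  coordinate bijection between them preserves boxes and their contents.\<close>

lemma has_integral_vec2_pair:
  fixes f :: "real \<times> real \<Rightarrow> real"
  assumes "(f has_integral i) (cbox (a, c) (b, d))"
  shows "((\<lambda>x :: real ^ 2. f (x $ 1, x $ 2)) has_integral i) (cbox (vector [a, c]) (vector [b, d]))"
proof -
  define g where "g \<equiv> \<lambda>x :: real ^ 2. (x $ 1, x $ 2)"
  define h where "h \<equiv> \<lambda>p :: real \<times> real. vector [fst p, snd p] :: real ^ 2"
  have hg: "h (g x) = x" and gh: "g (h p) = p" for x p
    by (simp_all add: g_def h_def vec_eq_iff forall_2)
  have g: "g ` cbox u v = cbox (g u) (g v)" for u v
  proof
    show "cbox (g u) (g v) \<subseteq> g ` cbox u v"
    proof
      fix p assume "p \<in> cbox (g u) (g v)"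
      then have "h p \<in> cbox u v"
        by (cases p) (auto simp: mem_cbox_vec2 g_def h_def cbox_Pair_eq)
      then show "p \<in> g ` cbox u v"
        using gh by (metis imageI)
    qed
  qed (auto simp: mem_cbox_vec2 g_def cbox_Pair_eq)
  have h: "h ` cbox p q = cbox (h p) (h q)" for p q
  proof -
    have "cbox p q = g ` cbox (h p) (h q)"
      by (simp add: g gh)
    then show ?thesis
      by (simp add: image_image hg)
  qed
  have "((\<lambda>x. f (g x)) has_integral (1 / 1) *\<^sub>R i) (h ` cbox (a, c) (b, d))"
  proof (rule has_integral_twiddle[OF _ hg gh _ _ _ _ assms])
    show "continuous (at x) g" for x
      unfolding g_def by (intro continuous_intros)
    show "measure lborel (g ` cbox u v) = 1 * measure lborel (cbox u v)" for u v
    proof (cases "u $ 1 \<le> v $ 1 \<and> u $ 2 \<le> v $ 2")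
      case True
      then show ?thesis
        unfolding g by (simp add: g_def content_Pair content_cbox_vec2)
    next
      case False
      then have "cbox u v = {}"
        by (auto simp: mem_cbox_vec2)
      then show ?thesis by simp
    qed
  qed (use g h in \<open>(simp; fail) | blast\<close>)+
  then show ?thesis
    by (simp add: h g_def) (simp add: h_def)
qed

text \<open>The bound rests on \<open>\<bar>1 + k\<bar>\<^sup>2 \<ge> 1 + 2 Re k\<close>, the mean of \<open>Re k\<close> being zero.\<close>

lemma holomorphic_image_area_ge:
  fixes F k :: "complex \<Rightarrow> complex"
  assumes F: "F holomorphic_on U" "open U" and Q: "cbox (Complex a c) (Complex b d) \<subseteq> U"
    and inj: "inj_on F (cbox (Complex a c) (Complex b d))"
    and le: "a \<le> b" "c \<le> d"
    and k: "continuous_on (cbox (Complex a c) (Complex b d)) k"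
    and dk: "\<And>z. z \<in> cbox (Complex a c) (Complex b d) \<Longrightarrow> cmod (deriv F z) = cmod (1 + k z)"
    and k0: "\<And>x. x \<in> {a..b} \<Longrightarrow> integral {c..d} (\<lambda>y. Re (k (Complex x y))) = 0"
  defines "R \<equiv> vec_of_complex ` F ` cbox (Complex a c) (Complex b d)"
  shows "R \<in> lmeasurable" "(b - a) * (d - c) \<le> measure lebesgue R"
proof -
  define Q' where "Q' = cbox (vector [a, c] :: real ^ 2) (vector [b, d])"
  define G where "G = vec_of_complex \<circ> F \<circ> complex_of_vec"
  define G' where "G' \<equiv> \<lambda>x h. vec_of_complex (deriv F (complex_of_vec x) * complex_of_vec h)"
  have Q'Q: "complex_of_vec x \<in> cbox (Complex a c) (Complex b d) \<longleftrightarrow> x \<in> Q'" for x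
    by (auto simp: Q'_def mem_cbox_vec2 in_cbox_complex_iff)
  have QQ': "complex_of_vec ` Q' = cbox (Complex a c) (Complex b d)"
    using Q'Q by (auto simp: image_iff) (metis vec_of_complex_inverse)
  have R: "R = G ` Q'"
    unfolding R_def G_def QQ'[symmetric] by (simp add: image_image)
  have der: "(G has_derivative G' x) (at x within Q')" if "x \<in> Q'" for x
  proof -
    have "complex_of_vec x \<in> U"
      using that Q Q'Q by blast
    then have "(F has_derivative (*) (deriv F (complex_of_vec x))) (at (complex_of_vec x))"
      using holomorphic_derivI[OF F] has_field_derivative_def by blast
    then have "((\<lambda>x. F (complex_of_vec x)) has_derivative (\<lambda>h. deriv F (complex_of_vec x) * complex_of_vec h)) (at x within Q')"
      by (rule has_derivative_compose[rotated])
        (rule bounded_linear_imp_has_derivative[OF bounded_linear_complex_of_vec])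
    from bounded_linear.has_derivative[OF bounded_linear_vec_of_complex this]
    show ?thesis
      by (simp add: G_def G'_def o_def)
  qed
  \<comment> \<open>Multiplication by a complex number, as a real matrix, has the squared modulus as
    its determinant.\<close>
  have det: "det (matrix (G' x)) = (cmod (deriv F (complex_of_vec x)))\<^sup>2" for x
    unfolding det_2 matrix_def cmod_power2
    by (simp add: G'_def axis_def power2_eq_square)
  have "inj_on G Q'"
  proof (rule inj_onI)
    fix x y assume xy: "x \<in> Q'" "y \<in> Q'" "G x = G y"
    then have "F (complex_of_vec x) = F (complex_of_vec y)"
      unfolding G_def o_def by (metis vec_of_complex_inverse)
    then have "complex_of_vec x = complex_of_vec y"
      using inj_onD[OF inj] xy Q'Q by blast
    then show "x = y"
      by (metis complex_of_vec_inverse)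
  qed
  have Q'm: "Q' \<in> sets lebesgue"
    by (simp add: Q'_def)
  have cont: "continuous_on Q' (\<lambda>x. (cmod (deriv F (complex_of_vec x)))\<^sup>2)"
    using Q Q'Q
    by (intro continuous_intros continuous_on_compose2[OF holomorphic_on_imp_continuous_on[OF holomorphic_deriv[OF F]]]
        linear_continuous_on bounded_linear_complex_of_vec) auto
  have int: "(\<lambda>x. \<bar>det (matrix (G' x))\<bar>) integrable_on Q'"
    unfolding det using integrable_continuous[OF cont[unfolded Q'_def]] by (simp add: Q'_def)
  show "R \<in> lmeasurable"
    unfolding R using measurable_differentiable_image_eq[OF Q'm der \<open>inj_on G Q'\<close>] int by blast
  have meas: "measure lebesgue R = integral Q' (\<lambda>x. (cmod (deriv F (complex_of_vec x)))\<^sup>2)"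
    unfolding R using measure_differentiable_image_eq[OF Q'm der \<open>inj_on G Q'\<close> int] by (simp add: det)
  \<comment> \<open>\<open>f\<close> is the minorant of the Jacobian. Integrating first in the
    second variable removes its \<open>k\<close> term by \<open>k0\<close>.\<close>
  define f where "f \<equiv> \<lambda>p. 1 + 2 * Re (k (Complex (fst p) (snd p)))"
  have contf: "continuous_on (cbox (a, c) (b, d)) f"
    unfolding f_def
    by (intro continuous_intros continuous_on_compose2[OF k])
      (auto simp: in_cbox_complex_iff cbox_Pair_eq)
  have contk: "continuous_on {c..d} (\<lambda>y. Re (k (Complex x y)))" if "x \<in> {a..b}" for x
    using that
    by (intro continuous_intros continuous_on_compose2[OF k]) (auto simp: in_cbox_complex_iff)
  have "integral (cbox (a, c) (b, d)) f = integral {a..b} (\<lambda>x. integral {c..d} (\<lambda>y. f (x, y)))"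
    using integral_prod_continuous[OF contf] by simp
  also have "\<dots> = integral {a..b} (\<lambda>x. d - c)"
  proof (rule integral_cong)
    fix x assume x: "x \<in> {a..b}"
    have "integral {c..d} (\<lambda>y. f (x, y)) = integral {c..d} (\<lambda>y. 1) + integral {c..d} (\<lambda>y. 2 * Re (k (Complex x y)))"
      unfolding f_def fst_conv snd_conv
      by (intro integral_add integrable_continuous_real continuous_intros contk x)
    then show "integral {c..d} (\<lambda>y. f (x, y)) = d - c"
      using k0[OF x] le by simp
  qed
  also have "\<dots> = (b - a) * (d - c)"
    using le by simp
  finally have "(f has_integral (b - a) * (d - c)) (cbox (a, c) (b, d))"
    using integrable_continuous[OF contf] has_integral_integral by metis
  then have "((\<lambda>x. f (x $ 1, x $ 2)) has_integral (b - a) * (d - c)) Q'"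
    unfolding Q'_def by (rule has_integral_vec2_pair)
  moreover have "((\<lambda>x. (cmod (deriv F (complex_of_vec x)))\<^sup>2) has_integral measure lebesgue R) Q'"
    unfolding meas using int by (simp add: det has_integral_integral)
  moreover have "f (x $ 1, x $ 2) \<le> (cmod (deriv F (complex_of_vec x)))\<^sup>2" if "x \<in> Q'" for x
  proof -
    have "f (x $ 1, x $ 2) = 1 + 2 * Re (k (complex_of_vec x))"
      by (simp add: f_def complex_of_vec_def)
    also have "\<dots> \<le> (cmod (1 + k (complex_of_vec x)))\<^sup>2"
      unfolding cmod_power2 by (simp add: power2_eq_square algebra_simps)
    also have "\<dots> = (cmod (deriv F (complex_of_vec x)))\<^sup>2"
      using dk that Q'Q by simp
    finally show ?thesis .
  qed
  ultimately show "(b - a) * (d - c) \<le> measure lebesgue R"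
    by (rule has_integral_le)
qed

text \<open>Inside \<open>ball 0 m\<close> the images of the open and the closed disc of radius
  \<rho> agree, since the bounding circle is mapped outside. This common set is open and closed in
  the ball and contains 0.\<close>

lemma injective_holomorphic_covers_ball:
  assumes t: "t holomorphic_on ball 0 1" "inj_on t (ball 0 1)" "t 0 = 0"
    and \<rho>: "0 < \<rho>" "\<rho> < 1" and m: "\<And>z. cmod z = \<rho> \<Longrightarrow> m \<le> cmod (t z)"
  shows "ball 0 m \<subseteq> t ` ball 0 \<rho>"
proof (cases "m > 0")
  case True
  have sub: "cball 0 \<rho> \<subseteq> ball 0 1" "ball 0 \<rho> \<subseteq> ball (0 :: complex) 1"
    using \<rho> by auto
  have op: "open (t ` ball 0 \<rho>)"
    by (rule open_mapping_thm3[OF holomorphic_on_subset[OF t(1) sub(2)] _ inj_on_subset[OF t(2) sub(2)]]) simp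
  have "compact (t ` cball 0 \<rho>)"
    by (intro compact_continuous_image continuous_on_subset[OF holomorphic_on_imp_continuous_on[OF t(1)] sub(1)]) simp
  then have cl: "closed (t ` cball 0 \<rho>)"
    by (rule compact_imp_closed)
  have eq: "ball 0 m \<inter> t ` ball 0 \<rho> = ball 0 m \<inter> t ` cball 0 \<rho>"
  proof -
    have "z \<in> ball 0 \<rho>" if "z \<in> cball 0 \<rho>" "t z \<in> ball 0 m" for z
      using m[of z] that by (cases "cmod z = \<rho>") auto
    then show ?thesis
      by (auto simp: image_iff)
  qed
  have "openin (top_of_set (ball 0 m)) (ball 0 m \<inter> t ` ball 0 \<rho>)"
    using op by (simp add: openin_open_Int)
  moreover have "closedin (top_of_set (ball 0 m)) (ball 0 m \<inter> t ` ball 0 \<rho>)"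
    unfolding eq using cl by (simp add: closedin_closed_Int)
  moreover have "0 \<in> ball 0 m \<inter> t ` ball 0 \<rho>"
    using True \<rho> t(3) by (auto simp: image_iff intro!: bexI[of _ 0])
  moreover have "connected (ball (0 :: complex) m)"
    by simp
  ultimately have "ball 0 m \<inter> t ` ball 0 \<rho> = ball 0 m"
    unfolding connected_clopen by blast
  then show ?thesis
    by blast
qed (simp add: ball_empty)

text \<open>The map \<open>\<Lambda>\<close> lifts \<open>t\<close> to logarithmic coordinates. The image of one period need not lie
  in a strip of height \<open>2 \<pi>\<close>; taking \<open>N\<close> periods makes the resulting error \<open>K\<close> negligible.\<close>

lemma Bieberbach_Eilenberg_circle_bound:
  assumes t: "t holomorphic_on ball 0 1" "inj_on t (ball 0 1)"
    and tg: "\<And>z. z \<in> ball 0 1 \<Longrightarrow> t z = z * exp (g z)" and g: "g holomorphic_on ball 0 1"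
    and BE: "\<And>z w. z \<in> ball 0 1 \<Longrightarrow> w \<in> ball 0 1 \<Longrightarrow> t z * t w \<noteq> 1"
    and \<rho>: "0 < \<rho>" "\<rho> < r" "r < 1" and m: "\<And>z. cmod z = \<rho> \<Longrightarrow> m \<le> cmod (t z)" "0 < m"
  shows "r * m \<le> \<rho>"
proof (rule ccontr)
  assume "\<not> ?thesis"
  then have rm: "\<rho> < r * m" by simp
  have t0: "t 0 = 0"
    using tg[of 0] by simp
  have cov: "ball 0 m \<subseteq> t ` ball 0 \<rho>"
    using injective_holomorphic_covers_ball[OF t t0 \<rho>(1) _ m(1)] \<rho> by simp
  \<comment> \<open>All values of modulus below \<open>m\<close> are already taken inside radius
    \<rho>, so injectivity excludes them on the annulus. The next bound excludes them for
    \<open>1 / t z\<close> by \<open>BE\<close>.\<close>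
  have lower: "m \<le> cmod (t z)" if z: "\<rho> \<le> cmod z" "cmod z < 1" for z
  proof (rule ccontr)
    assume "\<not> ?thesis"
    then have "t z \<in> ball 0 m"
      by simp
    then obtain z' where "z' \<in> ball 0 \<rho>" "t z = t z'"
      using cov by blast
    then show False
      using inj_onD[OF t(2), of z z'] z \<rho> by auto
  qed
  have upper: "cmod (t z) \<le> 1 / m" if z: "\<rho> \<le> cmod z" "cmod z < 1" for z
  proof (rule ccontr)
    assume "\<not> ?thesis"
    then have "1 / m < cmod (t z)" "0 < cmod (t z)"
      using m(2) lower[OF z] by linarith+
    then have "t z \<noteq> 0" "cmod (1 / t z) < m"
      using m(2) by (auto simp: norm_divide pos_divide_less_eq mult.commute)
    then have "t z \<noteq> 0" "1 / t z \<in> ball 0 m"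
      by simp_all
    then obtain z' where "z' \<in> ball 0 \<rho>" "1 / t z = t z'"
      using cov by blast
    then show False
      using BE[of z z'] z \<rho> \<open>t z \<noteq> 0\<close> by (auto simp: field_simps)
  qed
  define M where "M = - ln m"
  have M0: "0 \<le> M"
  proof -
    have "cmod (of_real \<rho>) = \<rho>"
      using \<rho> by simp
    then have "m \<le> 1 / m"
      using order_trans[OF lower upper, of "of_real \<rho>"] \<rho> by simp
    then have "m \<le> 1"
      using m(2) by (simp add: field_simps) (metis less_1_mult linorder_not_le)
    then show ?thesis
      using m(2) by (simp add: M_def)
  qed
  have "compact (g ` cball 0 r)"
    using \<rho> by (intro compact_continuous_image
        continuous_on_subset[OF holomorphic_on_imp_continuous_on[OF g]]) auto
  then have "bounded (g ` cball 0 r)"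
    by (rule compact_imp_bounded)
  then obtain K where "\<forall>x\<in>g ` cball 0 r. cmod x \<le> K"
    unfolding bounded_iff by auto
  then have K: "cmod (g z) \<le> K" if "cmod z \<le> r" for z
    using that by simp
  define U where "U = {\<zeta> :: complex. Re \<zeta> < 0}"
  have U: "open U"
    unfolding U_def by (rule open_halfspace_Re_lt)
  have eU: "exp \<zeta> \<in> ball 0 1" if "\<zeta> \<in> U" for \<zeta>
    using that by (simp add: U_def)
  define \<Lambda> where "\<Lambda> \<equiv> \<lambda>\<zeta>. \<zeta> + g (exp \<zeta>)"
  have exp\<Lambda>: "exp (\<Lambda> \<zeta>) = t (exp \<zeta>)" if "\<zeta> \<in> U" for \<zeta>
    using tg[OF eU[OF that]] by (simp add: \<Lambda>_def exp_add)
  define k where "k \<equiv> \<lambda>\<zeta>. exp \<zeta> * deriv g (exp \<zeta>)"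
  have dg: "((\<lambda>\<zeta>. g (exp \<zeta>)) has_field_derivative k \<zeta>) (at \<zeta>)" if "\<zeta> \<in> U" for \<zeta>
    using DERIV_chain2[OF holomorphic_derivI[OF g open_ball eU[OF that]] DERIV_exp]
    by (simp add: k_def mult.commute)
  have d\<Lambda>: "(\<Lambda> has_field_derivative 1 + k \<zeta>) (at \<zeta>)" if "\<zeta> \<in> U" for \<zeta>
    unfolding \<Lambda>_def by (intro derivative_intros dg that)
  have hol\<Lambda>: "\<Lambda> holomorphic_on U"
    using d\<Lambda> U by (metis holomorphic_on_open)
  have contk: "continuous_on U k"
    unfolding k_def
    by (intro continuous_intros continuous_on_compose2[OF
          holomorphic_on_imp_continuous_on[OF holomorphic_deriv[OF g open_ball]]])
      (use eU in auto)
  \<comment> \<open>Injectivity holds on the whole half-plane and not only modulo 2 pi i: if the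
    exponentials agree, the \<open>g\<close> terms cancel and leave \<open>x = y\<close>.\<close>
  have inj\<Lambda>: "inj_on \<Lambda> U"
  proof (rule inj_onI)
    fix x y assume xy: "x \<in> U" "y \<in> U" "\<Lambda> x = \<Lambda> y"
    then have "t (exp x) = t (exp y)"
      using exp\<Lambda> by metis
    then have "exp x = exp y"
      using inj_onD[OF t(2)] eU xy by blast
    then show "x = y"
      using xy(3) by (simp add: \<Lambda>_def)
  qed
  \<comment> \<open>The left side bounds from below the total area of two disjoint images of the
    rectangle \<open>Q\<close>; the right side is the area of a box containing both.\<close>
  have ineq: "2 * (ln r - ln \<rho>) * (2 * pi * N) \<le> 2 * M * (2 * pi * N + 2 * K)" for N :: nat
  proof -
    define Q where "Q = cbox (Complex (ln \<rho>) 0) (Complex (ln r) (2 * pi * N))"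
    have "ln r < 0"
      using \<rho> by simp
    then have QU: "Q \<subseteq> U"
      by (auto simp: Q_def U_def in_cbox_complex_iff)
    have le: "ln \<rho> \<le> ln r" "0 \<le> 2 * pi * N"
      using \<rho> by auto
    have eQ: "\<rho> \<le> cmod (exp \<zeta>)" "cmod (exp \<zeta>) \<le> r" if "\<zeta> \<in> Q" for \<zeta>
    proof -
      have "exp (ln \<rho>) \<le> exp (Re \<zeta>)" "exp (Re \<zeta>) \<le> exp (ln r)"
        using that by (simp_all add: Q_def in_cbox_complex_iff)
      then show "\<rho> \<le> cmod (exp \<zeta>)" "cmod (exp \<zeta>) \<le> r"
        using \<rho> by simp_all
    qed
    \<comment> \<open>On a vertical line \<open>\<i> * k\<close> is the derivative of
      \<open>g\<close> composed with \<open>exp\<close>, which is periodic; its integral over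
      \<open>N\<close> full periods vanishes.\<close>
    have k0: "integral {0..2 * pi * N} (\<lambda>y. Re (k (Complex x y))) = 0" if x: "x \<in> {ln \<rho>..ln r}" for x
    proof -
      have xU: "Complex x y \<in> U" for y
        using x \<open>ln r < 0\<close> by (auto simp: U_def)
      have "((\<lambda>y. g (exp (Complex x y))) has_vector_derivative \<i> * k (Complex x y)) (at y within A)" for y A
      proof -
        have "((\<lambda>y. Complex x y) has_vector_derivative \<i>) (at y within A)"
          unfolding Complex_eq by (auto intro!: derivative_eq_intros)
        then have "((\<lambda>\<zeta>. g (exp \<zeta>)) \<circ> (\<lambda>y. Complex x y) has_vector_derivative \<i> * k (Complex x y)) (at y within A)"
          by (rule field_vector_diff_chain_within) (rule has_field_derivative_at_within[OF dg[OF xU]])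
        then show ?thesis
          by (simp add: o_def)
      qed
      then have "((\<lambda>y. \<i> * k (Complex x y)) has_integral
          g (exp (Complex x (2 * pi * N))) - g (exp (Complex x 0))) {0..2 * pi * N}"
        using le(2) by (intro fundamental_theorem_of_calculus) auto
      moreover have "exp (Complex x (2 * pi * N)) = exp (Complex x 0)"
      proof -
        have "cis (2 * pi * N) = 1"
          using cis_multiple_2pi[of "real N"] by (simp add: mult_ac)
        then show ?thesis
          by (simp add: exp_eq_polar)
      qed
      ultimately have "((\<lambda>y. \<i> * k (Complex x y)) has_integral 0) {0..2 * pi * N}"
        by simp
      from has_integral_linear[OF this bounded_linear_Im]
      have "((\<lambda>y. Re (k (Complex x y))) has_integral 0) {0..2 * pi * N}"
        by (simp add: o_def)
      then show ?thesis
        by (rule integral_unique)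
    qed
    \<comment> \<open>\<Lambda>' is the logarithmic lift of \<open>1 / t\<close>. The shift by
      \<open>N\<close> periods places its image in the same box as that of \<Lambda>.\<close>
    define \<Lambda>' where "\<Lambda>' \<equiv> \<lambda>\<zeta>. \<i> * (2 * pi * N) - \<Lambda> \<zeta>"
    define R where "R = vec_of_complex ` \<Lambda> ` Q"
    define R' where "R' = vec_of_complex ` \<Lambda>' ` Q"
    have deriv\<Lambda>: "cmod (deriv \<Lambda> \<zeta>) = cmod (1 + k \<zeta>)" if "\<zeta> \<in> Q" for \<zeta>
      using DERIV_imp_deriv[OF d\<Lambda>] that QU by auto
    note ge = holomorphic_image_area_ge[OF hol\<Lambda> U QU[unfolded Q_def]
        inj_on_subset[OF inj\<Lambda> QU[unfolded Q_def]] le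
        continuous_on_subset[OF contk QU[unfolded Q_def]] deriv\<Lambda>[unfolded Q_def] k0]
    note area = ge[folded Q_def, folded R_def]
    have hol\<Lambda>': "\<Lambda>' holomorphic_on U"
      unfolding \<Lambda>'_def by (intro holomorphic_intros hol\<Lambda>)
    have "deriv \<Lambda>' \<zeta> = - (1 + k \<zeta>)" if "\<zeta> \<in> U" for \<zeta>
    proof (rule DERIV_imp_deriv)
      show "(\<Lambda>' has_field_derivative - (1 + k \<zeta>)) (at \<zeta>)"
        unfolding \<Lambda>'_def using d\<Lambda>[OF that] by (auto intro!: derivative_eq_intros)
    qed
    then have deriv\<Lambda>': "cmod (deriv \<Lambda>' \<zeta>) = cmod (1 + k \<zeta>)" if "\<zeta> \<in> Q" for \<zeta>
      using subsetD[OF QU that] by (metis norm_minus_cancel)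
    have inj\<Lambda>': "inj_on \<Lambda>' U"
      using inj\<Lambda> by (simp add: inj_on_def \<Lambda>'_def)
    \<comment> \<open>Only the modulus of the derivative enters the area bound, so the same
      \<open>k\<close> serves for the reflected map.\<close>
    note ge' = holomorphic_image_area_ge[OF hol\<Lambda>' U QU[unfolded Q_def]
        inj_on_subset[OF inj\<Lambda>' QU[unfolded Q_def]] le
        continuous_on_subset[OF contk QU[unfolded Q_def]] deriv\<Lambda>'[unfolded Q_def] k0]
    note area' = ge'[folded Q_def, folded R'_def]
    have expN: "exp (\<i> * (2 * pi * N)) = (1 :: complex)"
      using exp_2pi_1_int[of "int N"] by (simp add: mult_ac)
    have "R \<inter> R' = {}"
    proof (rule ccontr)
      assume "R \<inter> R' \<noteq> {}"
      then obtain x y where xy: "x \<in> Q" "y \<in> Q" "vec_of_complex (\<Lambda> x) = vec_of_complex (\<Lambda>' y)"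
        by (auto simp: R_def R'_def)
      have "\<Lambda> x = \<Lambda>' y"
        using xy(3) by (metis vec_of_complex_inverse)
      then have "exp (\<Lambda> x + \<Lambda> y) = 1"
        using expN by (simp add: \<Lambda>'_def)
      then have "t (exp x) * t (exp y) = 1"
        using exp\<Lambda> QU xy by (simp add: exp_add subset_eq)
      then show False
        using BE eU QU xy by blast
    qed
    \<comment> \<open>The horizontal bounds come from \<open>m \<le> cmod (t z) \<le> 1 / m\<close>;
      the vertical margin \<open>K\<close> bounds the difference between \<Lambda> and the
      identity.\<close>
    define B where "B = cbox (vector [- M, - K] :: real ^ 2) (vector [M, 2 * pi * N + K])"
    have bd: "- M \<le> Re (\<Lambda> \<zeta>)" "Re (\<Lambda> \<zeta>) \<le> M" "- K \<le> Im (\<Lambda> \<zeta>)" "Im (\<Lambda> \<zeta>) \<le> 2 * pi * N + K"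
      if "\<zeta> \<in> Q" for \<zeta>
    proof -
      have \<zeta>: "\<zeta> \<in> U" "cmod (exp \<zeta>) < 1"
        using that QU eU by auto
      have "cmod (t (exp \<zeta>)) = exp (Re (\<Lambda> \<zeta>))"
        using exp\<Lambda>[OF \<zeta>(1)] by (metis norm_exp_eq_Re)
      then have "m \<le> exp (Re (\<Lambda> \<zeta>))" "exp (Re (\<Lambda> \<zeta>)) \<le> 1 / m"
        using lower[OF eQ(1)[OF that] \<zeta>(2)] upper[OF eQ(1)[OF that] \<zeta>(2)] by simp_all
      moreover have "m = exp (- M)" "1 / m = exp M"
        using m(2) by (simp_all add: M_def exp_minus inverse_eq_divide)
      ultimately show "- M \<le> Re (\<Lambda> \<zeta>)" "Re (\<Lambda> \<zeta>) \<le> M"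
        by simp_all
      have "\<bar>Im (g (exp \<zeta>))\<bar> \<le> K"
        using K[OF eQ(2)[OF that]] abs_Im_le_cmod order_trans by blast
      then show "- K \<le> Im (\<Lambda> \<zeta>)" "Im (\<Lambda> \<zeta>) \<le> 2 * pi * N + K"
        using that by (auto simp: \<Lambda>_def Q_def in_cbox_complex_iff)
    qed
    have "R \<union> R' \<subseteq> B"
      using bd by (fastforce simp: R_def R'_def B_def mem_cbox_vec2 \<Lambda>'_def)
    moreover have "measure lebesgue (R \<union> R') = measure lebesgue R + measure lebesgue R'"
      using area(1) area'(1) \<open>R \<inter> R' = {}\<close>
      by (simp add: measure_Un3)
    moreover have "measure lebesgue (R \<union> R') \<le> measure lebesgue B"
      using \<open>R \<union> R' \<subseteq> B\<close> area(1) area'(1)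
      by (intro measure_mono_fmeasurable) (auto simp: B_def fmeasurableD)
    moreover have "measure lebesgue B = 2 * M * (2 * pi * N + 2 * K)"
    proof -
      have "0 \<le> K"
        using order_trans[OF norm_ge_zero K[of 0]] \<rho> by simp
      then have "measure lborel B = (M - - M) * (2 * pi * N + K - - K)"
        unfolding B_def using M0 le(2) by (subst content_cbox_vec2) auto
      then show ?thesis
        by (simp add: B_def measure_completion algebra_simps)
    qed
    moreover have "2 * (ln r - ln \<rho>) * (2 * pi * N) = 2 * ((ln r - ln \<rho>) * (2 * pi * N - 0))"
      by simp
    ultimately show ?thesis
      using area(2) area'(2) by linarith
  qed
  \<comment> \<open>\<open>c\<close> is the excess per unit height. If it were positive, its
    contribution would grow linearly in \<open>N\<close>, while the boundary error stays
    fixed.\<close>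
  define c where "c = ln r - ln \<rho> - M"
  have "ln \<rho> < ln (r * m)"
    using rm \<rho> m(2) by simp
  then have "0 < c"
    using \<rho> m(2) by (simp add: c_def M_def ln_mult)
  have "c * pi * N \<le> M * K" for N :: nat
    using ineq[of N] by (simp add: c_def algebra_simps)
  moreover obtain N :: nat where "M * K < N * (c * pi)"
    using reals_Archimedean3[of "c * pi"] \<open>0 < c\<close> by auto
  ultimately show False
    by (metis mult.commute not_le)
qed

text \<open>If the derivative exceeded 1, then \<open>\<rho> * c \<le> cmod (t z)\<close> would hold
  on a small circle of radius \<rho> for some \<open>c > 1\<close>. With \<open>r < 1\<close> and
  \<open>r * c > 1\<close> this contradicts the circle bound.\<close>

proposition Bieberbach_Eilenberg_injective:
  assumes t: "t holomorphic_on ball 0 1" "inj_on t (ball 0 1)" "t 0 = 0"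
    and BE: "\<And>z w. z \<in> ball 0 1 \<Longrightarrow> w \<in> ball 0 1 \<Longrightarrow> t z * t w \<noteq> 1"
  shows "cmod (deriv t 0) \<le> 1"
proof (rule ccontr)
  assume "\<not> ?thesis"
  then have gt: "1 < cmod (deriv t 0)" by simp
  obtain q where q: "q holomorphic_on ball 0 1" "\<And>z. cmod z < 1 \<Longrightarrow> t z = z * q z" "deriv t 0 = q 0"
    using Schwarz3[OF t(1,3)] by metis
  \<comment> \<open>The quotient \<open>t z / z\<close> is zero-free by injectivity away from 0 and
    by the size of the derivative at 0, so it has a holomorphic logarithm \<open>g\<close>.\<close>
  have "q z \<noteq> 0" if "z \<in> ball 0 1" for z
  proof (cases "z = 0")
    case False
    then show ?thesis
      using inj_onD[OF t(2), of z 0] q(2)[of z] that t(3) by auto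
  qed (use gt q(3) in auto)
  then obtain g where g: "g holomorphic_on ball 0 1" "\<And>z. z \<in> ball 0 1 \<Longrightarrow> q z = exp (g z)"
    using simply_connected_eq_holomorphic_log[OF open_ball, of 0 1] q(1)
      convex_imp_simply_connected[OF convex_ball] by metis
  define c where "c = (1 + cmod (q 0)) / 2"
  have c: "1 < c" "c < cmod (q 0)"
    using gt q(3) by (auto simp: c_def)
  have "continuous_on (ball 0 1) (\<lambda>z. cmod (q z))"
    by (intro continuous_intros holomorphic_on_imp_continuous_on q(1))
  then have "isCont (\<lambda>z. cmod (q z)) 0"
    by (simp add: continuous_on_eq_continuous_at)
  then have "\<forall>\<^sub>F z in at 0. c < cmod (q z)"
    using c(2) unfolding isCont_def by (rule order_tendstoD)
  then obtain d where d: "d > 0" "\<And>z. z \<noteq> 0 \<Longrightarrow> cmod z < d \<Longrightarrow> c < cmod (q z)"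
    unfolding eventually_at by (auto simp: dist_norm)
  define r where "r = (1 + 1 / c) / 2"
  have r: "0 < r" "r < 1" "1 < r * c"
    using c(1) by (auto simp: r_def field_simps)
  define \<rho> where "\<rho> = min d r / 2"
  have \<rho>: "0 < \<rho>" "\<rho> < r" "\<rho> < d"
    using d(1) r by (auto simp: \<rho>_def)
  have lower: "\<rho> * c \<le> cmod (t z)" if "cmod z = \<rho>" for z
    using d(2)[of z] q(2)[of z] that \<rho> r by (auto simp: norm_mult)
  have tg: "t z = z * exp (g z)" if "z \<in> ball 0 1" for z
    using q(2)[of z] g(2)[OF that] that by simp
  have "0 < \<rho> * c"
    using \<rho>(1) c(1) by simp
  have "r * (\<rho> * c) \<le> \<rho>"
    by (rule Bieberbach_Eilenberg_circle_bound[OF t(1,2) tg g(1) BE \<rho>(1,2) r(2) lower \<open>0 < \<rho> * c\<close>])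
  then show False
    using r(3) \<rho>(1) by (simp add: mult.left_commute)
qed

section \<open>Koebe quarter theorem\<close>

text \<open>The normalised square root \<open>s\<close> never takes two opposite values. The Cayley
  transform turns \<open>s\<close> into \<open>t\<close> and the opposite of \<open>s\<close> into
  \<open>1 / t\<close>, so \<open>t\<close> satisfies the Bieberbach-Eilenberg condition.\<close>

proposition Koebe_omitted_value:
  assumes \<psi>: "\<psi> holomorphic_on ball 0 1" "inj_on \<psi> (ball 0 1)"
    and nz: "\<And>z. z \<in> ball 0 1 \<Longrightarrow> \<psi> z \<noteq> 0"
  shows "cmod (deriv \<psi> 0) \<le> 4 * cmod (\<psi> 0)"
proof -
  have hol: "(\<lambda>z. \<psi> z / \<psi> 0) holomorphic_on ball 0 1"
    using nz by (auto intro!: holomorphic_intros \<psi>)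
  have nz': "\<forall>z\<in>ball 0 1. \<psi> z / \<psi> 0 \<noteq> 0"
    using nz by auto
  have "simply_connected (ball (0 :: complex) 1)"
    by (simp add: convex_imp_simply_connected)
  then have "\<exists>g. g holomorphic_on ball 0 1 \<and> (\<forall>z\<in>ball 0 1. \<psi> z / \<psi> 0 = (g z)\<^sup>2)"
    using hol nz' unfolding simply_connected_eq_holomorphic_sqrt[OF open_ball] by blast
  then obtain g where g: "g holomorphic_on ball 0 1"
    "\<And>z. z \<in> ball 0 1 \<Longrightarrow> \<psi> z / \<psi> 0 = (g z)\<^sup>2"
    by blast
  have g0: "(g 0)\<^sup>2 = 1"
    using g(2)[of 0] nz[of 0] by simp
  define s where "s \<equiv> \<lambda>z. g z / g 0"
  have s: "s holomorphic_on ball 0 1" "s 0 = 1"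
    using g0 unfolding s_def by (auto intro!: holomorphic_intros g)
  have sq: "\<psi> z = \<psi> 0 * (s z)\<^sup>2" if "z \<in> ball 0 1" for z
    using g(2)[OF that] nz[of 0] g0 by (simp add: s_def power_divide field_simps)
  have inj: "z = w" if "z \<in> ball 0 1" "w \<in> ball 0 1" "(s z)\<^sup>2 = (s w)\<^sup>2" for z w
    using inj_onD[OF \<psi>(2) _ that(1,2)] sq[OF that(1)] sq[OF that(2)] that(3) by simp
  have s_nz: "s z \<noteq> 0" if "z \<in> ball 0 1" for z
    using sq[OF that] nz[OF that] by auto
  have opp: "s z \<noteq> - s w" if "z \<in> ball 0 1" "w \<in> ball 0 1" for z w
  proof
    assume "s z = - s w"
    then have "z = w"
      using inj[OF that] by simp
    then show False
      using s_nz[OF that(1)] \<open>s z = - s w\<close> by simp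
  qed
  have s1: "s z + 1 \<noteq> 0" if "z \<in> ball 0 1" for z
    using opp[OF that, of 0] s(2) by (auto simp: add_eq_0_iff2)
  define t where "t \<equiv> \<lambda>z. (s z - 1) / (s z + 1)"
  have t: "t holomorphic_on ball 0 1"
    unfolding t_def by (intro holomorphic_intros s) (use s1 in auto)
  have "inj_on t (ball 0 1)"
  proof (rule inj_onI)
    fix z w :: complex assume zw: "z \<in> ball 0 1" "w \<in> ball 0 1" "t z = t w"
    then have "(s z - 1) * (s w + 1) = (s w - 1) * (s z + 1)"
      using s1 by (simp add: t_def frac_eq_eq)
    then have "s z = s w"
      by (simp add: algebra_simps)
    then show "z = w"
      using inj zw by simp
  qed
  moreover have "t z * t w \<noteq> 1" if "z \<in> ball 0 1" "w \<in> ball 0 1" for z w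
  proof
    assume "t z * t w = 1"
    then have "(s z - 1) * (s w - 1) = (s z + 1) * (s w + 1)"
      using s1[OF that(1)] s1[OF that(2)] by (simp add: t_def)
    then have "2 * (s z + s w) = 0"
      by (simp add: algebra_simps)
    then show False
      using opp[OF that] by (simp add: add_eq_0_iff2)
  qed
  ultimately have "cmod (deriv t 0) \<le> 1"
    using t s(2) by (intro Bieberbach_Eilenberg_injective) (auto simp: t_def)
  \<comment> \<open>One factor 2 comes from squaring \<open>s\<close>, the other from the Cayley
    transform, whose derivative at 1 is 1/2.\<close>
  moreover have "deriv \<psi> 0 = 4 * \<psi> 0 * deriv t 0"
  proof -
    have ds: "(s has_field_derivative deriv s 0) (at 0)"
      using holomorphic_derivI[OF s(1)] by simp
    have "((\<lambda>z. s z - 1) has_field_derivative deriv s 0) (at 0)"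
      "((\<lambda>z. s z + 1) has_field_derivative deriv s 0) (at 0)"
      using DERIV_diff[OF ds DERIV_const[of 1]] DERIV_add[OF ds DERIV_const[of 1]] by simp_all
    from DERIV_divide[OF this] have "(t has_field_derivative deriv s 0 / 2) (at 0)"
      using s(2) by (simp add: t_def)
    moreover have "((\<lambda>z. \<psi> 0 * (s z)\<^sup>2) has_field_derivative \<psi> 0 * (2 * deriv s 0)) (at 0)"
      using ds s(2) by (auto intro!: derivative_eq_intros)
    then have "(\<psi> has_field_derivative \<psi> 0 * (2 * deriv s 0)) (at 0)"
      by (rule has_field_derivative_transform_within_open[of _ _ _ "ball 0 1"]) (auto simp: sq[symmetric])
    ultimately show ?thesis
      by (simp add: DERIV_imp_deriv)
  qed
  moreover have "\<psi> 0 \<noteq> 0"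
    using nz by simp
  ultimately show ?thesis
    by (simp add: norm_mult)
qed

text \<open>The Riemann map is normalised by a disc automorphism to vanish at \<zeta>. Its inverse,
  shifted by \<open>c\<close>, omits 0, and the derivatives of the two maps multiply to 1.\<close>

lemma Riemann_map_Koebe:
  assumes G: "open G" "simply_connected G" "c \<notin> G" "\<zeta> \<in> G"
  obtains f where "f holomorphic_on G" "f ` G \<subseteq> ball 0 1" "f \<zeta> = 0"
    "1 \<le> 4 * cmod (\<zeta> - c) * cmod (deriv f \<zeta>)"
proof -
  obtain p q where p: "p holomorphic_on G" "\<And>z. z \<in> G \<Longrightarrow> p z \<in> ball 0 1 \<and> q (p z) = z"
    and q: "q holomorphic_on ball 0 1" "\<And>z. z \<in> ball 0 1 \<Longrightarrow> q z \<in> G \<and> p (q z) = z"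
    using Riemann_mapping_theorem[of G] G by blast
  have "p \<zeta> \<in> ball 0 1"
    using p(2)[OF G(4)] by blast
  then obtain h k where h: "h (p \<zeta>) = 0" "h holomorphic_on ball 0 1" "h ` ball 0 1 \<subseteq> ball 0 1"
      "k holomorphic_on ball 0 1" "k ` ball 0 1 \<subseteq> ball 0 1"
      "\<And>z. z \<in> ball 0 1 \<Longrightarrow> h (k z) = z" "\<And>z. z \<in> ball 0 1 \<Longrightarrow> k (h z) = z"
    using ball_biholomorphism_exists by metis
  note hk = h(3,5)[unfolded image_subset_iff, rule_format] h(6,7)
  define f where "f = h \<circ> p"
  define \<psi> where "\<psi> \<equiv> \<lambda>z. q (k z) - c"
  have f: "f holomorphic_on G"
    unfolding f_def using p h by (intro holomorphic_on_compose_gen[of _ _ _ "ball 0 1"]) auto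
  have qk: "(\<lambda>z. q (k z)) holomorphic_on ball 0 1"
    using holomorphic_on_compose_gen[OF h(4) q(1) h(5)] by (simp add: o_def)
  have \<psi>: "\<psi> holomorphic_on ball 0 1"
    unfolding \<psi>_def by (intro holomorphic_intros qk)
  have inv: "f (\<psi> z + c) = z" if "z \<in> ball 0 1" for z
    using q(2) hk that by (simp add: f_def \<psi>_def)
  have "inj_on \<psi> (ball 0 1)"
    by (rule inj_on_inverseI[of _ "\<lambda>z. f (z + c)"]) (rule inv)
  moreover have "\<psi> z \<noteq> 0" if "z \<in> ball 0 1" for z
    using q(2)[OF hk(2)[OF that]] G(3) by (auto simp: \<psi>_def)
  ultimately have K: "cmod (deriv \<psi> 0) \<le> 4 * cmod (\<psi> 0)"
    by (rule Koebe_omitted_value[OF \<psi>])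
  have "k 0 = p \<zeta>"
    using hk(4)[of "p \<zeta>"] h(1) p(2)[OF G(4)] by simp
  then have \<psi>0: "\<psi> 0 = \<zeta> - c"
    using p(2)[OF G(4)] by (simp add: \<psi>_def)
  have "(f has_field_derivative deriv f \<zeta>) (at (\<psi> 0 + c))"
    using holomorphic_derivI[OF f G(1,4)] \<psi>0 by simp
  moreover have "((\<lambda>z. \<psi> z + c) has_field_derivative deriv \<psi> 0) (at 0)"
    using holomorphic_derivI[OF \<psi> open_ball, of 0] by (auto intro!: derivative_eq_intros)
  ultimately have "((\<lambda>z. f (\<psi> z + c)) has_field_derivative deriv f \<zeta> * deriv \<psi> 0) (at 0)"
    by (rule DERIV_chain2)
  then have "((\<lambda>z. z) has_field_derivative deriv f \<zeta> * deriv \<psi> 0) (at 0)"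
    by (rule has_field_derivative_transform_within_open[of _ _ _ "ball 0 1"]) (use inv in auto)
  then have "deriv f \<zeta> * deriv \<psi> 0 = 1"
    using DERIV_unique DERIV_ident by blast
  then have "1 = cmod (deriv \<psi> 0) * cmod (deriv f \<zeta>)"
    by (metis mult.commute norm_mult norm_one)
  also have "\<dots> \<le> 4 * cmod (\<zeta> - c) * cmod (deriv f \<zeta>)"
    using K \<psi>0 by (intro mult_right_mono) auto
  finally show ?thesis
    using that[OF f] hk(1) p(2) h(1) by (auto simp: f_def image_subset_iff)
qed

section \<open>Invariant metrics\<close>

definition caratheodory_candidates :: "(complex ^ 'n) set \<Rightarrow> complex ^ 'n \<Rightarrow> (complex ^ 'n \<Rightarrow> complex) set" where
  "caratheodory_candidates D z = {f. holomorphic_fun_on f D \<and> f ` D \<subseteq> ball 0 1 \<and> f z = 0}"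

definition kobayashi_radius :: "(complex ^ 'n) set \<Rightarrow> complex ^ 'n \<Rightarrow> complex ^ 'n \<Rightarrow> real \<Rightarrow> bool" where
  "kobayashi_radius D z X \<alpha> \<longleftrightarrow> \<alpha> \<ge> 0 \<and>
     (\<exists>\<phi>. holomorphic_curve_on \<phi> (ball 0 1) \<and> \<phi> ` ball 0 1 \<subseteq> D \<and>
        \<phi> 0 = z \<and> complex_of_real \<alpha> *s curve_deriv \<phi> 0 = X)"

lemma caratheodory_metric_eq:
  "caratheodory_metric D z X =
     Sup ((\<lambda>f. norm (frechet_derivative f (at z) X)) ` caratheodory_candidates D z)"
  unfolding caratheodory_metric_def caratheodory_candidates_def by (simp add: setcompr_eq_image)

lemma kobayashi_metric_eq: "kobayashi_metric D z X = Inf {\<alpha>. kobayashi_radius D z X \<alpha>}"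
  unfolding kobayashi_metric_def kobayashi_radius_def ..

lemma holomorphic_curve_has_derivative:
  fixes \<phi> :: "complex \<Rightarrow> complex ^ 'n"
  assumes "holomorphic_curve_on \<phi> U" "open U" "t \<in> U"
  shows "(\<phi> has_derivative (\<lambda>s. s *s curve_deriv \<phi> t)) (at t)"
  unfolding has_derivative_componentwise_within[of \<phi>]
proof
  fix e :: "complex ^ 'n" assume "e \<in> Basis"
  then obtain i b where e: "e = axis i b" "b \<in> Basis"
    by (auto simp: Basis_vec_def)
  have "((\<lambda>t. \<phi> t $ i) has_field_derivative curve_deriv \<phi> t $ i) (at t)"
    using holomorphic_derivI[OF _ assms(2,3)] assms(1)
    by (simp add: holomorphic_curve_on_def curve_deriv_def)
  then have "((\<lambda>t. \<phi> t $ i) has_derivative (\<lambda>s. s * curve_deriv \<phi> t $ i)) (at t)"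
    by (simp add: has_field_derivative_def mult_commute_abs)
  from has_derivative_inner_left[OF this, of b]
  show "((\<lambda>x. \<phi> x \<bullet> e) has_derivative (\<lambda>x. (x *s curve_deriv \<phi> t) \<bullet> e)) (at t)"
    by (simp add: e inner_axis)
qed

text \<open>The composition of \<open>f\<close> with the disc \<phi> is a self-map of the unit disc
  fixing 0, so the Schwarz lemma bounds its derivative by 1.\<close>

lemma caratheodory_le_kobayashi_radius:
  assumes f: "f \<in> caratheodory_candidates D z" and \<alpha>: "kobayashi_radius D z X \<alpha>"
  shows "norm (frechet_derivative f (at z) X) \<le> \<alpha>"
proof -
  have \<alpha>0: "\<alpha> \<ge> 0"
    using \<alpha> by (simp add: kobayashi_radius_def)
  obtain \<phi> where "holomorphic_curve_on \<phi> (ball 0 1) \<and> \<phi> ` ball 0 1 \<subseteq> D \<and>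
      \<phi> 0 = z \<and> complex_of_real \<alpha> *s curve_deriv \<phi> 0 = X"
    using \<alpha>[unfolded kobayashi_radius_def, THEN conjunct2] ..
  note \<phi> = this[THEN conjunct1] this[THEN conjunct2, THEN conjunct1]
    this[THEN conjunct2, THEN conjunct2, THEN conjunct1]
    this[THEN conjunct2, THEN conjunct2, THEN conjunct2]
  have f': "holomorphic_fun_on f D" "f ` D \<subseteq> ball 0 1" "f z = 0"
    using f by (auto simp: caratheodory_candidates_def)
  define L where "L \<equiv> \<lambda>x. frechet_derivative f (at x)"
  have L: "(f has_derivative L x) (at x)" "L x (c *s v) = c * L x v" if "x \<in> D" for x c v
  proof -
    have "\<exists>l. (f has_derivative l) (at x) \<and> (\<forall>c v. l (c *s v) = c * l v)"
      using f'(1) that by (simp add: holomorphic_fun_on_def)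
    then obtain l where l: "(f has_derivative l) (at x) \<and> (\<forall>c v. l (c *s v) = c * l v)" ..
    then have "l = L x"
      unfolding L_def by (intro frechet_derivative_at) (rule conjunct1)
    then show "(f has_derivative L x) (at x)" "L x (c *s v) = c * L x v"
      using l by simp_all
  qed
  have der: "((\<lambda>t. f (\<phi> t)) has_field_derivative L (\<phi> t) (curve_deriv \<phi> t)) (at t)"
    if t: "t \<in> ball 0 1" for t
  proof -
    have "\<phi> t \<in> D"
      using \<phi>(2) t by blast
    have "((\<lambda>t. f (\<phi> t)) has_derivative (\<lambda>s. L (\<phi> t) (s *s curve_deriv \<phi> t))) (at t)"
      by (rule has_derivative_compose[OF holomorphic_curve_has_derivative[OF \<phi>(1) open_ball t]
            L(1)[OF \<open>\<phi> t \<in> D\<close>]])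
    then show ?thesis
      using L(2)[OF \<open>\<phi> t \<in> D\<close>] by (simp add: has_field_derivative_def mult_commute_abs)
  qed
  then have "(\<lambda>t. f (\<phi> t)) holomorphic_on ball 0 1"
    using holomorphic_on_open[OF open_ball] by blast
  moreover have "norm (f (\<phi> t)) < 1" if "norm t < 1" for t
    using f'(2) \<phi>(2) that by (auto simp: image_subset_iff)
  ultimately have "norm (deriv (\<lambda>t. f (\<phi> t)) 0) \<le> 1"
    using f'(3) \<phi>(3) by (intro Schwarz_Lemma(2)[of _ 0]) auto
  then have "norm (L z (curve_deriv \<phi> 0)) \<le> 1"
    using DERIV_imp_deriv[OF der[of 0]] \<phi>(3) by simp
  moreover have "z \<in> D"
    using \<phi>(2,3) by force
  then have "L z X = \<alpha> * L z (curve_deriv \<phi> 0)"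
    using L(2) \<phi>(4) by metis
  ultimately show ?thesis
    using \<alpha>0 by (simp add: L_def norm_mult mult_left_le)
qed

text \<open>The affine disc of radius \<open>r\<close> in direction \<open>X\<close> has derivative
  \<open>r X\<close> at its centre.\<close>

lemma affine_disc_kobayashi_radius:
  assumes "r > 0" "\<And>t. norm t < r \<Longrightarrow> z + t *s X \<in> D"
  shows "kobayashi_radius D z X (1 / r)"
proof -
  define \<phi> where "\<phi> \<equiv> \<lambda>t. z + (of_real r * t) *s X"
  have nth: "\<phi> t $ i = z $ i + of_real r * X $ i * t" for t i
    by (simp add: \<phi>_def)
  have "deriv (\<lambda>t. \<phi> t $ i) 0 = of_real r * X $ i" for i
    unfolding nth by (rule DERIV_imp_deriv) (auto intro!: derivative_eq_intros)
  then have "complex_of_real (1 / r) *s curve_deriv \<phi> 0 = X"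
    using assms(1) by (simp add: curve_deriv_def vec_eq_iff)
  moreover have "holomorphic_curve_on \<phi> (ball 0 1)"
    unfolding holomorphic_curve_on_def nth by (intro allI holomorphic_intros)
  moreover have "\<phi> t \<in> D" if "t \<in> ball 0 1" for t
  proof -
    have "norm (of_real r * t) < r"
      using that assms(1) by (simp add: norm_mult)
    then show ?thesis
      unfolding \<phi>_def by (rule assms(2))
  qed
  ultimately show ?thesis
    using assms(1) unfolding kobayashi_radius_def
    by (intro conjI exI[of _ \<phi>]) (auto simp: \<phi>_def)
qed

text \<open>The candidate is a Riemann map of the projected domain after the projection along the
  supporting hyperplane. The distance to the omitted value contributes \<open>t\<close> times the
  form at \<open>X\<close>, and the latter factor is the one in the derivative along
  \<open>X\<close>.\<close>

lemma C_convex_caratheodory_candidate: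
  assumes D: "complex_domain D" "C_convex D" "z \<in> D" and w: "z + t *s X \<notin> D"
  obtains f where "f \<in> caratheodory_candidates D z"
    "1 \<le> 4 * norm t * norm (frechet_derivative f (at z) X)"
proof -
  have D': "open D" "connected D" "D \<noteq> {}"
    using D(1) by (auto simp: complex_domain_def)
  obtain a where a: "\<And>x. x \<in> D \<Longrightarrow> linear_form a (x - (z + t *s X)) \<noteq> 0"
    using C_convex_supporting_hyperplane[OF D'(1) D(2) D'(3) w] by metis
  define G where "G = linear_form a ` D"
  define c where "c = linear_form a (z + t *s X)"
  \<comment> \<open>This vector witnesses that the form is not zero, as the image lemma
    requires.\<close>
  have "linear_form a (z - (z + t *s X)) \<noteq> 0"
    by (rule a[OF D(3)])
  then have G: "open G" "simply_connected G"
    unfolding G_def by (rule C_convex_linear_form_image[OF D'(1) D(2) D'(2)])+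
  have "c \<notin> G"
    using a by (fastforce simp: G_def c_def)
  moreover have "linear_form a z \<in> G"
    using D(3) by (simp add: G_def)
  ultimately obtain g where g: "g holomorphic_on G" "g ` G \<subseteq> ball 0 1" "g (linear_form a z) = 0"
    "1 \<le> 4 * cmod (linear_form a z - c) * cmod (deriv g (linear_form a z))"
    using Riemann_map_Koebe[OF G] by metis
  define f where "f \<equiv> \<lambda>x. g (linear_form a x)"
  have df: "(f has_derivative (\<lambda>v. deriv g (linear_form a x) * linear_form a v)) (at x)"
    if "x \<in> D" for x
  proof -
    have "linear_form a x \<in> G"
      using that by (simp add: G_def)
    then have "(g has_derivative (*) (deriv g (linear_form a x))) (at (linear_form a x))"
      using holomorphic_derivI[OF g(1) G(1)] by (simp add: has_field_derivative_def)
    moreover have "(linear_form a has_derivative linear_form a) (at x)"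
      using linear_linear_form linear_conv_bounded_linear bounded_linear_imp_has_derivative by blast
    ultimately show ?thesis
      unfolding f_def by (rule has_derivative_compose[rotated])
  qed
  have "f \<in> caratheodory_candidates D z"
    unfolding caratheodory_candidates_def holomorphic_fun_on_def
  proof (intro CollectI conjI ballI)
    fix x assume "x \<in> D"
    show "\<exists>L. (f has_derivative L) (at x) \<and> (\<forall>c v. L (c *s v) = c * L v)"
      by (intro exI conjI, rule df[OF \<open>x \<in> D\<close>]) simp
  qed (use g(2,3) in \<open>auto simp: f_def G_def image_subset_iff\<close>)
  moreover have "frechet_derivative f (at z) X = deriv g (linear_form a z) * linear_form a X"
    using frechet_derivative_at[OF df[OF D(3)]] by metis
  moreover have "linear_form a z - c = - (t * linear_form a X)"
    by (simp add: c_def)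
  ultimately show ?thesis
    using that[of f] g(4) by (simp add: norm_mult mult_ac)
qed

theorem proposition1:
  fixes D :: "(complex ^ 'n) set" and z X :: "complex ^ 'n"
  assumes "complex_domain D" and "C_convex D"
    and "z \<in> D" and "X \<noteq> 0"
    and "\<not> complex_line z X \<subseteq> D"
  shows "1 / 4 \<le> caratheodory_metric D z X * directional_dist D z X \<and>
         caratheodory_metric D z X * directional_dist D z X
           \<le> kobayashi_metric D z X * directional_dist D z X \<and>
         kobayashi_metric D z X * directional_dist D z X \<le> 1"
proof -
  define \<gamma> \<kappa> d where "\<gamma> = caratheodory_metric D z X" and "\<kappa> = kobayashi_metric D z X"
    and "d = directional_dist D z X"
  define S where "S = {r. r > 0 \<and> (\<forall>t::complex. norm t < r \<longrightarrow> z + t *s X \<in> D)}"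
  define \<Gamma> where "\<Gamma> = (\<lambda>f. norm (frechet_derivative f (at z) X)) ` caratheodory_candidates D z"
  have \<gamma>: "\<gamma> = Sup \<Gamma>" and \<kappa>: "\<kappa> = Inf {\<alpha>. kobayashi_radius D z X \<alpha>}" and d: "d = Sup S"
    by (simp_all add: \<gamma>_def \<kappa>_def d_def \<Gamma>_def S_def caratheodory_metric_eq kobayashi_metric_eq
        directional_dist_def)
  have "open {t. z + t *s X \<in> D}"
    using C_convex_slice(1)[OF _ assms(2)] assms(1) by (simp add: complex_domain_def)
  moreover have "0 \<in> {t. z + t *s X \<in> D}"
    using assms(3) by simp
  ultimately obtain r0 where r0: "r0 > 0" "ball 0 r0 \<subseteq> {t. z + t *s X \<in> D}"
    by (rule openE)
  then have S0: "r0 \<in> S"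
    by (auto simp: S_def)
  obtain t0 where t0: "z + t0 *s X \<notin> D"
    using assms(5) by (auto simp: complex_line_def)
  have bdd: "bdd_above S"
  proof (rule bdd_aboveI)
    fix r assume "r \<in> S"
    then show "r \<le> norm t0"
      using t0 by (auto simp: S_def not_less[symmetric])
  qed
  have d0: "0 < d"
    using cSup_upper[OF S0 bdd] r0(1) d by simp
  have disc: "kobayashi_radius D z X (1 / r)" if "r \<in> S" for r
    using that by (intro affine_disc_kobayashi_radius) (auto simp: S_def)
  have bddK: "bdd_below {\<alpha>. kobayashi_radius D z X \<alpha>}"
    by (rule bdd_belowI[of _ 0]) (simp add: kobayashi_radius_def)
  have \<Gamma>\<alpha>: "x \<le> \<alpha>" if "x \<in> \<Gamma>" "kobayashi_radius D z X \<alpha>" for x \<alpha>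
    using that caratheodory_le_kobayashi_radius by (auto simp: \<Gamma>_def)
  have bdd\<Gamma>: "bdd_above \<Gamma>"
    by (rule bdd_aboveI) (rule \<Gamma>\<alpha>[OF _ disc[OF S0]])
  have ball4: "1 \<le> 4 * norm t * \<gamma>" if t: "z + t *s X \<notin> D" for t
  proof -
    obtain f where f: "f \<in> caratheodory_candidates D z"
      "1 \<le> 4 * norm t * norm (frechet_derivative f (at z) X)"
      using C_convex_caratheodory_candidate[OF assms(1-3) t] by metis
    have "norm (frechet_derivative f (at z) X) \<le> \<gamma>"
      unfolding \<gamma> by (rule cSup_upper[OF _ bdd\<Gamma>]) (use f(1) in \<open>simp add: \<Gamma>_def\<close>)
    then have "4 * norm t * norm (frechet_derivative f (at z) X) \<le> 4 * norm t * \<gamma>"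
      by (intro mult_left_mono) auto
    then show ?thesis
      using f(2) by linarith
  qed
  have \<gamma>0: "0 < \<gamma>"
  proof (rule ccontr)
    assume "\<not> 0 < \<gamma>"
    then have "4 * norm t0 * \<gamma> \<le> 0"
      by (intro mult_nonneg_nonpos) auto
    then show False
      using ball4[OF t0] by linarith
  qed
  have "1 / (4 * \<gamma>) \<le> d"
  \<comment> \<open>A radius slightly larger than \<open>d\<close> is not admissible, so some point
    outside \<open>D\<close> has parameter of modulus below \<open>d + e\<close>, and
    \<open>ball4\<close> applies to it.\<close>
  proof (rule field_le_epsilon)
    fix e :: real assume "e > 0"
    then have "d + e \<notin> S"
      using cSup_upper[OF _ bdd, of "d + e"] d by auto
    then obtain t where t: "norm t < d + e" "z + t *s X \<notin> D"
      using d0 \<open>e > 0\<close> by (auto simp: S_def)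
    have "1 / (4 * \<gamma>) \<le> norm t"
      using ball4[OF t(2)] \<gamma>0 by (simp add: divide_le_eq mult_ac)
    then show "1 / (4 * \<gamma>) \<le> d + e"
      using t(1) by simp
  qed
  then have lower: "1 / 4 \<le> \<gamma> * d"
    using \<gamma>0 by (simp add: divide_le_eq mult_ac)
  have "\<gamma> \<le> \<kappa>"
  proof -
    have "(\<lambda>_. 0) \<in> caratheodory_candidates D z"
      by (auto simp: caratheodory_candidates_def holomorphic_fun_on_def intro!: exI[of _ "\<lambda>_. 0"])
    then have "\<Gamma> \<noteq> {}"
      by (auto simp: \<Gamma>_def)
    then show ?thesis
      unfolding \<gamma> \<kappa> using disc[OF S0] \<Gamma>\<alpha> by (intro cInf_greatest cSup_least) auto
  qed
  then have middle: "\<gamma> * d \<le> \<kappa> * d"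
    using d0 by (intro mult_right_mono) auto
  have \<kappa>0: "0 < \<kappa>"
    using \<gamma>0 \<open>\<gamma> \<le> \<kappa>\<close> by linarith
  have "d \<le> 1 / \<kappa>"
    unfolding d
  proof (rule cSup_least)
    fix r assume r: "r \<in> S"
    have "\<kappa> \<le> 1 / r"
      unfolding \<kappa> by (rule cInf_lower[OF _ bddK]) (simp add: disc[OF r])
    then show "r \<le> 1 / \<kappa>"
      using \<kappa>0 r by (simp add: S_def field_simps)
  qed (use S0 in auto)
  then have "\<kappa> * d \<le> 1"
    using \<kappa>0 by (simp add: field_simps)
  with lower middle show ?thesis
    by (simp add: \<gamma>_def \<kappa>_def d_def)
qed

end
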